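(* Let $p,q$ be integers with $p,q\ge3$ and $1/p+1/q>1/2$, let $N_0$, $\mathcal V=\{1,\dots,N_0\}$, $\mathbf{\Gamma}^{\{p,q\}}$, $R_i$, $\sigma_i$ ($i\in\mathcal V$) and $\mathcal{M}_{\{p,q\}}$ be as in the context. Let $\mathcal{G}_{\{p,q\}}$ be a graph on $\mathcal V$ that is undirected and connected and such that every $\sigma_i$, $i\in\mathcal V$, is a graph automorphism of $\mathcal G_{\{p,q\}}$. Let $h:\mathbb{R}\to\mathbb{R}$ be such that $h\circ\arccos$ is Lipschitz on $[-1,1]$. Then $\mathcal{M}_{\{p,q\}}$ is an invariant set of the closed-loop system $$\dot\Gamma_i=\widehat{\Gamma}_i\sum_{j\in\mathcal{N}_i}h(\theta_{ij})\,\widehat{\Gamma}_i\Gamma_j,\qquad \Gamma_i\in\mathcal S^2,\ i\in\mathcal V,$$ where $\mathcal N_i$ is the neighbor set of $i$ in $\mathcal G_{\{p,q\}}$.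
   Context: $\mathcal{S}^2$ is the unit sphere in $\mathbb{R}^3$; $\widehat{x}$ is the matrix with $\widehat{x}y=x\times y$; $\theta_{ij}=\arccos(\Gamma_i^T\Gamma_j)$. $N_0=4p/d$ with $d=4-(p-2)(q-2)$ is the number of vertices of the regular polyhedron $\{p,q\}$ (regular $p$-gon faces, $q$ faces at each vertex). $\mathbf{\Gamma}^{\{p,q\}}=(\Gamma^{\{p,q\}}_1,\dots,\Gamma^{\{p,q\}}_{N_0})$ is an enumeration of the vertices of a regular polyhedron $\{p,q\}$ inscribed in the unit sphere centered at the origin; $\mathcal{M}_{\{p,q\}}=\{(R\Gamma^{\{p,q\}}_1,\dots,R\Gamma^{\{p,q\}}_{N_0}):R\in\mathcal{SO}(3)\}$. $R_i(\mathbf\Gamma)=\exp(\tfrac{2\pi}{q}\widehat\Gamma_i)$ and $\sigma_i$ is the permutation of $\mathcal V$ with $\Gamma^{\{p,q\}}_{\sigma_i(k)}=R_i(\mathbf{\Gamma}^{\{p,q\}})\Gamma^{\{p,q\}}_k$ for all $k$. A permutation $\sigma$ of $\mathcal V$ is a graph automorphism of $\mathcal G=(\mathcal V,\mathcal E)$ if $(\sigma(i),\sigma(j))\in\mathcal E\iff(i,j)\in\mathcal E$. *)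

theory Defs
  imports "HOL-Analysis.Analysis"
begin

text \<open>hat x: the matrix with hat x *v y = x \<times> y (cross product).\<close>
definition hat :: "real^3 \<Rightarrow> real^3^3" where
  "hat x = matrix (\<lambda>y. cross3 x y)"

text \<open>Matrix powers and the matrix exponential (power series).\<close>
fun mpow :: "real^3^3 \<Rightarrow> nat \<Rightarrow> real^3^3" where
  "mpow A 0 = mat 1"
| "mpow A (Suc n) = A ** mpow A n"

definition mexp :: "real^3^3 \<Rightarrow> real^3^3" where
  "mexp A = (\<Sum>n. (1 / fact n) *\<^sub>R mpow A n)"

definition SO3 :: "(real^3^3) set" where
  "SO3 = {R. orthogonal_matrix R \<and> det R = 1}"

text \<open>Number of vertices N0 = 4p/d with d = 4 - (p-2)(q-2).\<close>
definition N0 :: "nat \<Rightarrow> nat \<Rightarrow> nat" where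
  "N0 p q = nat ((4 * int p) div (4 - (int p - 2) * (int q - 2)))"

definition vertices_of :: "(real^3) set \<Rightarrow> (real^3) set" where
  "vertices_of P = {v. v extreme_point_of P}"

text \<open>A (convex) regular p-gon: a planar convex polygon with p vertices,
  all edges of equal length and all vertices on a common circle
  (equilateral + cyclic).\<close>
definition regular_polygon :: "nat \<Rightarrow> (real^3) set \<Rightarrow> bool" where
  "regular_polygon p F \<longleftrightarrow>
     polytope F \<and> aff_dim F = 2 \<and> card (vertices_of F) = p \<and>
     (\<exists>c r. \<forall>w\<in>vertices_of F. dist c w = r) \<and>
     (\<exists>l. \<forall>e. e face_of F \<and> aff_dim e = 1 \<longrightarrow>
            (\<exists>a b. e = closed_segment a b \<and> dist a b = l))"

text \<open>S is the vertex set of a regular polyhedron {p,q} (convex, regular p-gon faces,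
  q faces meeting at each vertex).\<close>
definition regular_polyhedron_vertices :: "nat \<Rightarrow> nat \<Rightarrow> (real^3) set \<Rightarrow> bool" where
  "regular_polyhedron_vertices p q S \<longleftrightarrow>
     finite S \<and> aff_dim (convex hull S) = 3 \<and> vertices_of (convex hull S) = S \<and>
     (\<forall>F. F face_of (convex hull S) \<and> aff_dim F = 2 \<longrightarrow> regular_polygon p F) \<and>
     (\<forall>v\<in>S. card {F. F face_of (convex hull S) \<and> aff_dim F = 2 \<and> v \<in> F} = q)"

text \<open>Undirected connected graph on V with edge set E.\<close>
definition undirected_connected_graph :: "nat set \<Rightarrow> (nat \<times> nat) set \<Rightarrow> bool" where
  "undirected_connected_graph V E \<longleftrightarrow>
     E \<subseteq> V \<times> V \<and> sym E \<and> (\<forall>i\<in>V. \<forall>j\<in>V. (i, j) \<in> E\<^sup>*)"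

definition graph_automorphism :: "nat set \<Rightarrow> (nat \<times> nat) set \<Rightarrow> (nat \<Rightarrow> nat) \<Rightarrow> bool" where
  "graph_automorphism V E \<sigma> \<longleftrightarrow> bij_betw \<sigma> V V \<and>
     (\<forall>i\<in>V. \<forall>j\<in>V. (\<sigma> i, \<sigma> j) \<in> E \<longleftrightarrow> (i, j) \<in> E)"

text \<open>Right-hand side of the closed-loop system for agent i.\<close>
definition closed_loop_rhs ::
  "(real \<Rightarrow> real) \<Rightarrow> (nat \<times> nat) set \<Rightarrow> (nat \<Rightarrow> real^3) \<Rightarrow> nat \<Rightarrow> real^3" where
  "closed_loop_rhs h E G i =
     hat (G i) *v (\<Sum>j\<in>{j. (i, j) \<in> E}. h (arccos (G i \<bullet> G j)) *\<^sub>R (hat (G i) *v G j))"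

end

theory Submission
  imports Defs
begin

text \<open>
  Every configuration in \<open>M\<close> is an equilibrium. Indeed \<open>\<sigma>\<^sub>i\<close> fixes \<open>i\<close> and permutes its neighbours, so
  \<open>\<Sum>\<^sub>j h(\<theta>\<^sub>i\<^sub>j) \<Gamma>\<^sub>j\<close> is invariant under the rotation about \<open>\<Gamma>\<^sub>i\<close> by \<open>2\<pi>/q\<close> and hence parallel to \<open>\<Gamma>\<^sub>i\<close>.
  The vector field is Lipschitz on the product of spheres, so by Gronwall a solution starting in \<open>M\<close> is constant.

  The substance is that these rotations permute the vertices. All edges have the same
  length since the facets are connected through edges. The neighbours of a vertex \<open>v\<close> lie on a
  circle about \<open>v\<close>, and two neighbours in a common facet have a distance determined by \<open>p\<close> and span a
  chord that supports the neighbour set; this forces them to be the orbit of one of them under the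
  rotation by \<open>2\<pi>/q\<close>. So the image of one edge determines where a rotation maps all
  adjacent edges, and a rotation that maps one edge to an edge maps every edge to an edge.
\<close>

unbundle cross3_syntax

subsection \<open>Rotations\<close>

text \<open>Rodrigues' formula; a rotation only for unit vectors \<open>n\<close>.\<close>

definition rot :: "real^3 \<Rightarrow> real \<Rightarrow> real^3 \<Rightarrow> real^3" where
  "rot n t y = cos t *\<^sub>R y + sin t *\<^sub>R (n \<times> y) + ((1 - cos t) * (n \<bullet> y)) *\<^sub>R n"

lemma rot_0 [simp]: "rot n 0 y = y"
  by (simp add: rot_def)

lemma rot_axis: "norm n = 1 \<Longrightarrow> rot n t n = n"
  by (simp add: rot_def cross_refl dot_square_norm algebra_simps)

lemma linear_rot: "linear (rot n t)"
  by (rule linearI)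
    (simp_all add: rot_def cross_add_right cross_mult_right inner_add_right algebra_simps)

lemma hat_mult [simp]: "hat n *v y = n \<times> y"
proof -
  have "linear ((\<times>) n)"
    using bilinear_cross by (simp add: bilinear_def)
  then show ?thesis
    by (simp add: hat_def matrix_works)
qed

lemma cross_cross_unit: "norm n = 1 \<Longrightarrow> n \<times> (n \<times> y) = (n \<bullet> y) *\<^sub>R n - y"
  by (simp add: Lagrange dot_square_norm)

lemma inner_rot_axis: "norm n = 1 \<Longrightarrow> n \<bullet> rot n t y = n \<bullet> y"
  by (simp add: rot_def inner_add_right dot_cross_self dot_square_norm algebra_simps)

lemma rot_add:
  assumes "norm n = 1"
  shows "rot n s (rot n t y) = rot n (s + t) y"
proof -
  have "n \<times> rot n t y = cos t *\<^sub>R (n \<times> y) + sin t *\<^sub>R ((n \<bullet> y) *\<^sub>R n - y)"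
    by (simp add: rot_def cross_add_right cross_mult_right cross_refl cross_cross_unit assms)
  then have "rot n s (rot n t y) = cos s *\<^sub>R rot n t y
     + sin s *\<^sub>R (cos t *\<^sub>R (n \<times> y) + sin t *\<^sub>R ((n \<bullet> y) *\<^sub>R n - y)) + ((1 - cos s) * (n \<bullet> y)) *\<^sub>R n"
    by (simp add: rot_def[of n s] inner_rot_axis assms)
  then show ?thesis
    by (simp add: rot_def cos_add sin_add algebra_simps)
qed

lemma inner_rot_gen:
  assumes "norm n = 1"
  shows "a \<bullet> rot n t x = (n \<bullet> x) * (a \<bullet> n) + cos t * (a \<bullet> (x - (n \<bullet> x) *\<^sub>R n)) + sin t * (a \<bullet> (n \<times> x))"
  by (simp add: rot_def inner_add_right inner_diff_right algebra_simps)

lemma inner_rot_self: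
  assumes "norm n = 1"
  shows "x \<bullet> rot n t x = (n \<bullet> x)\<^sup>2 + ((norm x)\<^sup>2 - (n \<bullet> x)\<^sup>2) * cos t"
  by (simp add: rot_def inner_add_right dot_cross_self dot_square_norm inner_commute
      power2_eq_square algebra_simps)

lemma norm_rot:
  assumes "norm n = 1"
  shows "norm (rot n t y) = norm y"
proof -
  define w where "w = n \<times> y"
  have dots: "n \<bullet> n = 1" "w \<bullet> n = 0" "n \<bullet> w = 0" "w \<bullet> y = 0" "y \<bullet> w = 0" "y \<bullet> n = n \<bullet> y"
      "w \<bullet> w = y \<bullet> y - (n \<bullet> y)\<^sup>2"
    using norm_cross[of n y] assms
    by (simp_all add: w_def dot_cross_self inner_commute power2_norm_eq_inner[symmetric])
  have "rot n t y \<bullet> rot n t y = (cos t)\<^sup>2 * (y \<bullet> y) + (sin t)\<^sup>2 * (y \<bullet> y - (n \<bullet> y)\<^sup>2)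
     + (1 - cos t)\<^sup>2 * (n \<bullet> y)\<^sup>2 + 2 * cos t * (1 - cos t) * (n \<bullet> y)\<^sup>2"
    unfolding rot_def w_def[symmetric]
    by (simp add: inner_add_left inner_add_right dots) (simp add: power2_eq_square algebra_simps)
  also have "\<dots> = y \<bullet> y"
    unfolding sin_squared_eq by (simp add: power2_eq_square algebra_simps)
  finally show ?thesis
    by (metis norm_eq_sqrt_inner)
qed

text \<open>This is the chord formula: \<open>(norm x)^2 - (n \<bullet> x)^2\<close> is the squared
  radius of the circle that \<open>x\<close> describes about \<open>n\<close>.\<close>

lemma dist_rot:
  assumes "norm n = 1"
  shows "(dist x (rot n t x))\<^sup>2 = 2 * ((norm x)\<^sup>2 - (n \<bullet> x)\<^sup>2) * (1 - cos t)"
proof -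
  have "(dist x (rot n t x))\<^sup>2 = (norm x)\<^sup>2 + (norm (rot n t x))\<^sup>2 - 2 * (x \<bullet> rot n t x)"
    by (simp add: dist_norm power2_norm_eq_inner inner_diff_left inner_diff_right inner_commute)
  then show ?thesis
    by (simp add: norm_rot inner_rot_self assms algebra_simps)
qed

lemma rot_periodic: "rot n (t + 2 * pi) y = rot n t y" "rot n (t - 2 * pi) y = rot n t y"
  by (simp_all add: rot_def cos_diff sin_diff)

text \<open>The remainder \<open>u\<close> is orthogonal to all three vectors. By Lagrange's
  identity it is then also parallel to \<open>n \<times> e\<close>, hence zero.\<close>

lemma orthogonal_expansion:
  fixes n e v :: "real^3"
  assumes "norm n = 1" "norm e = 1" "n \<bullet> e = 0"
  shows "v = (v \<bullet> n) *\<^sub>R n + (v \<bullet> e) *\<^sub>R e + (v \<bullet> (n \<times> e)) *\<^sub>R (n \<times> e)"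
proof -
  define u where "u = v - ((v \<bullet> n) *\<^sub>R n + (v \<bullet> e) *\<^sub>R e + (v \<bullet> (n \<times> e)) *\<^sub>R (n \<times> e))"
  have ne: "norm (n \<times> e) = 1"
    using norm_cross[of n e] assms by (simp add: power2_eq_1_iff) (metis norm_ge_zero not_one_le_zero neg_0_le_iff_le)
  have "e \<bullet> n = 0" using assms by (simp add: inner_commute)
  then have "u \<bullet> n = 0" "u \<bullet> e = 0" "u \<bullet> (n \<times> e) = 0"
    using assms ne by (simp_all add: u_def inner_diff_left inner_add_left dot_cross_self dot_square_norm)
  then have "u \<times> (n \<times> e) = 0"
    by (simp add: Lagrange)
  then have "u = 0"
    using norm_cross[of u "n \<times> e"] ne \<open>u \<bullet> (n \<times> e) = 0\<close> by simp
  then show ?thesis by (simp add: u_def)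
qed

text \<open>Both points lie on one circle about the axis \<open>n\<close>, of positive radius by
  \<open>pos\<close>. The angle is read off in the frame of \<open>e\<close>, the direction of
  \<open>x\<close> within the plane of the circle, and \<open>n \<times> e\<close>.\<close>

lemma rot_exists:
  assumes n: "norm n = 1" and eq: "n \<bullet> y = n \<bullet> x" "norm y = norm x" and pos: "(n \<bullet> x)\<^sup>2 < (norm x)\<^sup>2"
  obtains t where "-pi < t" "t \<le> pi" "y = rot n t x"
proof -
  define c where "c = n \<bullet> x"
  define r where "r = sqrt ((norm x)\<^sup>2 - c\<^sup>2)"
  have r: "r > 0" "r\<^sup>2 = (norm x)\<^sup>2 - c\<^sup>2" using pos by (auto simp: r_def c_def)
  have nn: "n \<bullet> n = 1" using n by (simp add: dot_square_norm)
  have part: "norm (z - c *\<^sub>R n) = r" if "n \<bullet> z = c" "norm z = norm x" for z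
  proof -
    have "(norm (z - c *\<^sub>R n))\<^sup>2 = r\<^sup>2"
      using that nn unfolding r that(2)[symmetric] power2_norm_eq_inner
      by (simp add: inner_diff_left inner_diff_right inner_commute power2_eq_square)
    then show ?thesis using r by (metis less_imp_le norm_ge_zero power2_eq_imp_eq)
  qed
  define e where "e = (1 / r) *\<^sub>R (x - c *\<^sub>R n)"
  define f where "f = (1 / r) *\<^sub>R (y - c *\<^sub>R n)"
  have e: "norm e = 1" "n \<bullet> e = 0" and f: "norm f = 1" "f \<bullet> n = 0"
    using part[of x] part[of y] eq r nn
    by (simp_all add: e_def f_def c_def inner_diff_right inner_diff_left inner_commute)
  have fexp: "f = (f \<bullet> e) *\<^sub>R e + (f \<bullet> (n \<times> e)) *\<^sub>R (n \<times> e)"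
    using orthogonal_expansion[OF n e, of f] f by simp
  have ne: "norm (n \<times> e) = 1"
    using norm_cross[of n e] n e by (simp add: power2_eq_1_iff) (metis norm_ge_zero not_one_le_zero neg_0_le_iff_le)
  have "(norm f)\<^sup>2 = (f \<bullet> e)\<^sup>2 + (f \<bullet> (n \<times> e))\<^sup>2"
  proof -
    have "f \<bullet> f = f \<bullet> ((f \<bullet> e) *\<^sub>R e + (f \<bullet> (n \<times> e)) *\<^sub>R (n \<times> e))"
      using fexp by simp
    then show ?thesis
      by (simp add: inner_add_right power2_eq_square dot_square_norm)
  qed
  then have "(f \<bullet> e)\<^sup>2 + (f \<bullet> (n \<times> e))\<^sup>2 = 1" using f by simp
  from sincos_total_2pi_le[OF this] obtain s where s: "0 \<le> s" "s \<le> 2 * pi" "f \<bullet> e = cos s" "f \<bullet> (n \<times> e) = sin s"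
    by blast
  have "y = c *\<^sub>R n + r *\<^sub>R f" using r by (simp add: f_def)
  also have "\<dots> = c *\<^sub>R n + cos s *\<^sub>R (r *\<^sub>R e) + sin s *\<^sub>R (n \<times> (r *\<^sub>R e))"
    by (subst fexp) (simp add: s cross_mult_right algebra_simps)
  also have "r *\<^sub>R e = x - c *\<^sub>R n" using r by (simp add: e_def)
  also have "c *\<^sub>R n + cos s *\<^sub>R (x - c *\<^sub>R n) + sin s *\<^sub>R (n \<times> (x - c *\<^sub>R n)) = rot n s x"
    by (simp add: rot_def Cross3.right_diff_distrib cross_mult_right cross_refl c_def algebra_simps)
  finally have y: "y = rot n s x" .
  \<comment> \<open>The angle is shifted from a full turn starting at 0 to one centred at 0, where
    \<open>arccos (cos t)\<close> is the absolute value of \<open>t\<close>.\<close>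
  show ?thesis
  proof (cases "s \<le> pi")
    case True
    show ?thesis by (rule that[of s]) (use s True y pi_gt_zero in linarith)+
  next
    case False
    show ?thesis by (rule that[of "s - 2 * pi"]) (use s False y in \<open>auto simp: rot_periodic\<close>)
  qed
qed

section \<open>Rotation matrices and the matrix exponential\<close>

lemma SO3_inner: "R \<in> SO3 \<Longrightarrow> (R *v x) \<bullet> (R *v y) = x \<bullet> y"
  using orthogonal_transformation_matrix[of "(*v) R"]
  by (auto simp: SO3_def orthogonal_transformation_def)

lemma SO3_cross: "R \<in> SO3 \<Longrightarrow> (R *v x) \<times> (R *v y) = R *v (x \<times> y)"
  by (intro cross_rotation_matrix) (simp add: SO3_def rotation_matrix_def)

lemma SO3_rot: "R \<in> SO3 \<Longrightarrow> R *v rot n t x = rot (R *v n) t (R *v x)"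
  by (simp add: rot_def SO3_inner SO3_cross matrix_vector_right_distrib matrix_vector_mult_scaleR)

text \<open>The determinant of a rotation is the square of the determinant of its half-angle rotation.\<close>

lemma rot_SO3:
  assumes "norm n = 1"
  obtains R where "R \<in> SO3" "\<And>x. R *v x = rot n t x"
proof -
  have lin: "linear (rot n s)" for s by (rule linear_rot)
  have ort: "orthogonal_matrix (matrix (rot n s))" for s
    using orthogonal_transformation_matrix[of "rot n s"] lin assms
    by (simp add: orthogonal_transformation norm_rot)
  have "rot n t = rot n (t/2) \<circ> rot n (t/2)"
    by (simp add: fun_eq_iff rot_add assms)
  then have "matrix (rot n t) = matrix (rot n (t/2)) ** matrix (rot n (t/2))"
    using matrix_compose[OF lin lin] by metis
  then have "det (matrix (rot n t)) = det (matrix (rot n (t/2))) * det (matrix (rot n (t/2)))"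
    by (simp add: det_mul)
  moreover have "\<bar>det (matrix (rot n (t/2)))\<bar> = 1"
    using det_orthogonal_matrix[OF ort, of "t/2"] by (elim disjE) simp_all
  ultimately have "det (matrix (rot n t)) = 1"
    by (metis abs_mult_self_eq mult_1)
  then show ?thesis
    by (intro that[of "matrix (rot n t)"]) (auto simp: SO3_def ort matrix_works lin)
qed

text \<open>For a unit axis the matrix satisfies \<open>K ** (K ** K) = - K\<close>, so every
  positive power of it is a multiple of \<open>K\<close> or of \<open>K ** K\<close>. The two
  coefficient series are those of sine and cosine.\<close>

lemma mexp_hat:
  assumes "norm n = 1"
  shows "mexp (t *\<^sub>R hat n) *v y = rot n t y"
proof -
  define K where "K = hat n"
  define M where "M k = (1 / fact k) *\<^sub>R mpow (t *\<^sub>R K) k" for k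
  have K3: "K ** (K ** K) = (-1) *\<^sub>R K"
    unfolding K_def matrix_eq scaleR_matrix_vector_assoc[symmetric]
    by (simp add: matrix_vector_mul_assoc[symmetric] cross_cross_unit assms Cross3.right_diff_distrib cross_mult_right cross_refl)
  have sub: "A ** (B - C) = A ** B - A ** C" for A B C :: "real^3^3"
    by (simp add: matrix_matrix_mult_def vec_eq_iff right_diff_distrib sum_subtractf)
  \<comment> \<open>Writing the powers with \<open>sin_coeff\<close> and \<open>cos_coeff\<close>
    covers both parities at once. The last summand corrects the power 0, where the general pattern
    would give \<open>- (K ** K)\<close> instead of the identity.\<close>
  have *: "mpow (t *\<^sub>R K) k = (fact k * sin_coeff k * t ^ k) *\<^sub>R K - (fact k * cos_coeff k * t ^ k) *\<^sub>R (K ** K)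
      + (if k = 0 then mat 1 + K ** K else 0)" for k
  proof (induction k)
    case 0
    then show ?case by (simp add: sin_coeff_def cos_coeff_def)
  next
    case (Suc k)
    have "(1::real) + real k \<noteq> 0" by linarith
    then have a: "fact (Suc k) * sin_coeff (Suc k) = fact k * cos_coeff k"
       "fact (Suc k) * cos_coeff (Suc k) = - (fact k * sin_coeff k)"
      by (simp_all add: sin_coeff_Suc cos_coeff_Suc field_simps)
    have "mpow (t *\<^sub>R K) (Suc k) = t *\<^sub>R (K ** mpow (t *\<^sub>R K) k)"
      by (simp add: scalar_matrix_assoc)
    also have "K ** mpow (t *\<^sub>R K) k = (fact k * sin_coeff k * t ^ k) *\<^sub>R (K ** K)
        + (fact k * cos_coeff k * t ^ k) *\<^sub>R K"
      unfolding Suc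
      by (simp add: matrix_add_ldistrib sub matrix_scalar_ac scalar_matrix_assoc[symmetric] K3)
    finally show ?case
      unfolding a by (simp add: algebra_simps)
  qed
  have M: "M k = (sin_coeff k * t ^ k) *\<^sub>R K - (cos_coeff k * t ^ k) *\<^sub>R (K ** K)
      + (if k = 0 then mat 1 + K ** K else 0)" for k
    unfolding M_def * by (simp add: algebra_simps)
  have "M sums (sin t *\<^sub>R K - cos t *\<^sub>R (K ** K) + (mat 1 + K ** K))"
    unfolding M using sin_converges[of t] cos_converges[of t]
    by (intro sums_add sums_diff sums_scaleR_left) (use sums_single[of 0 "\<lambda>_. mat 1 + K ** K"] in auto)
  then have *: "mexp (t *\<^sub>R hat n) = sin t *\<^sub>R hat n - cos t *\<^sub>R (hat n ** hat n) + (mat 1 + hat n ** hat n)"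
    unfolding mexp_def M_def K_def by (rule sums_unique[symmetric])
  show ?thesis
    unfolding *
    by (simp add: rot_def matrix_vector_mult_add_rdistrib matrix_vector_mult_diff_rdistrib
        scaleR_matrix_vector_assoc[symmetric] matrix_vector_mul_assoc[symmetric] cross_cross_unit assms algebra_simps)
qed

subsection \<open>Points on a circle\<close>

text \<open>The half-angle formulas factor the difference into positive sines. Geometrically, an
  open arc lies strictly beyond the chord between its ends.\<close>

lemma sin_chord_less:
  fixes s :: real
  assumes "0 < s" "s < \<alpha>" "\<alpha> < pi"
  shows "sin \<alpha> * (1 - cos s) < sin s * (1 - cos \<alpha>)"
proof -
  have half: "1 - cos x = 2 * (sin (x/2))\<^sup>2" "sin x = 2 * sin (x/2) * cos (x/2)" for x :: real
    using cos_double_sin[of "x/2"] sin_double[of "x/2"] by simp_all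
  have "sin s * (1 - cos \<alpha>) - sin \<alpha> * (1 - cos s) = 4 * sin (s/2) * sin (\<alpha>/2) * sin (\<alpha>/2 - s/2)"
    unfolding half[of s] half[of \<alpha>] sin_diff by (simp add: power2_eq_square algebra_simps)
  moreover have "sin (s/2) > 0" "sin (\<alpha>/2) > 0" "sin (\<alpha>/2 - s/2) > 0"
    using assms by (auto intro!: sin_gt_zero)
  ultimately show ?thesis
    by (metis diff_gt_0_iff_gt mult_pos_pos zero_less_numeral)
qed

lemma cos_less_one:
  fixes x :: real
  assumes "0 < x" "x < 2 * pi"
  shows "cos x < 1"
proof -
  have "sin (x/2) > 0" using assms by (intro sin_gt_zero) auto
  then show ?thesis using cos_double_sin[of "x/2"] by simp
qed

text \<open>The two vectors in \<open>A\<close> and \<open>B\<close> span the plane orthogonal to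
  \<open>n\<close>, so \<open>a\<close> must be a multiple of \<open>n\<close>. This excludes a
  supporting functional that is constant on the whole circle.\<close>

lemma axis_if_orthogonal_to_circle:
  assumes n: "norm n = 1" and pos: "(n \<bullet> w)\<^sup>2 < (norm w)\<^sup>2"
    and A: "a \<bullet> (w - (n \<bullet> w) *\<^sub>R n) = 0" and B: "a \<bullet> (n \<times> w) = 0"
  shows "n \<times> a = 0"
proof -
  define u where "u = w - (n \<bullet> w) *\<^sub>R n"
  have "u \<noteq> 0"
  proof
    assume "u = 0"
    then have "w = (n \<bullet> w) *\<^sub>R n" by (simp add: u_def)
    then have "norm w = \<bar>n \<bullet> w\<bar>" using n by (metis norm_scaleR mult_1_right)
    then show False using pos by simp
  qed
  define e where "e = (1 / norm u) *\<^sub>R u"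
  have e: "norm e = 1" "n \<bullet> e = 0"
    using n \<open>u \<noteq> 0\<close> by (simp_all add: e_def u_def inner_diff_right dot_square_norm)
  have "a \<bullet> e = 0" "a \<bullet> (n \<times> e) = 0"
    using A B by (simp_all add: e_def u_def cross_mult_right Cross3.right_diff_distrib cross_refl)
  then have *: "a = (a \<bullet> n) *\<^sub>R n"
    using orthogonal_expansion[OF n e, of a] by simp
  show ?thesis
    by (subst *) (simp add: cross_mult_right cross_refl)
qed

text \<open>A chord whose line supports \<open>V\<close> cuts off an arc free of points of \<open>V\<close>. As all these chords
  have the same length, \<open>V\<close> is invariant under one rotation angle and has no points in between.\<close>

lemma circle_orbit:
  fixes n :: "real^3"
  assumes n: "norm n = 1" and ne: "V \<noteq> {}"
    and circ: "\<And>w. w \<in> V \<Longrightarrow> norm w = 1" "\<And>w. w \<in> V \<Longrightarrow> n \<bullet> w = c"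
    and d: "d > 0"
    and nb: "\<And>w. w \<in> V \<Longrightarrow> \<exists>w1\<in>V. \<exists>w2\<in>V. w1 \<noteq> w2 \<and> (\<forall>x\<in>{w1,w2}. dist w x = d \<and>
               (\<exists>a. n \<times> a \<noteq> 0 \<and> a \<bullet> x = a \<bullet> w \<and> (\<forall>z\<in>V. a \<bullet> z \<le> a \<bullet> w)))"
  obtains \<alpha> where "0 < \<alpha>" "\<alpha> < pi" "\<alpha> = 2 * pi / real (card V)"
    "c\<^sup>2 < 1" "d\<^sup>2 = 2 * (1 - c\<^sup>2) * (1 - cos \<alpha>)"
    "\<And>w. w \<in> V \<Longrightarrow> V = (\<lambda>k. rot n (real k * \<alpha>) w) ` {..<card V}"
    "\<And>w x. \<lbrakk>w \<in> V; x \<in> V; dist w x = d\<rbrakk> \<Longrightarrow> x = rot n \<alpha> w \<or> x = rot n (-\<alpha>) w"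
    "\<And>w. w \<in> V \<Longrightarrow> rot n \<alpha> w \<noteq> rot n (-\<alpha>) w"
proof -
  \<comment> \<open>With \<open>c^2 = 1\<close> the circle would shrink to a point, but
    \<open>V\<close> contains two points at the positive distance \<open>d\<close>.\<close>
  have c: "c\<^sup>2 < 1"
  proof -
    have e: "(norm (w - c *\<^sub>R n))\<^sup>2 = 1 - c\<^sup>2" if "w \<in> V" for w
    proof -
      have "w \<bullet> w = 1" "n \<bullet> n = 1" using that circ n by (simp_all add: dot_square_norm)
      moreover have "n \<bullet> w = c" using that circ by simp
      ultimately show ?thesis
        unfolding power2_norm_eq_inner
        by (simp add: inner_diff_left inner_diff_right inner_commute power2_eq_square)
    qed
    obtain w w1 where w: "w \<in> V" "w1 \<in> V" "dist w w1 = d" using ne nb by blast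
    have "1 - c\<^sup>2 \<noteq> 0"
      using e[OF w(1)] e[OF w(2)] w(3) d by auto
    moreover have "1 - c\<^sup>2 \<ge> 0" using e[OF w(1)] by (metis zero_le_power2)
    ultimately show ?thesis by linarith
  qed
  \<comment> \<open>The angle that a chord of length \<open>d\<close> subtends at the centre of the
    circle, obtained by solving the chord formula.\<close>
  define \<alpha> where "\<alpha> = arccos (1 - d\<^sup>2 / (2 * (1 - c\<^sup>2)))"
  have chord: "(dist w (rot n t w))\<^sup>2 = 2 * (1 - c\<^sup>2) * (1 - cos t)" if "w \<in> V" for w t
    using dist_rot[OF n, of w t] circ that by simp
  have angle: "\<exists>t. -pi < t \<and> t \<le> pi \<and> x = rot n t w" if "w \<in> V" "x \<in> V" for w x
  proof -
    have "n \<bullet> x = n \<bullet> w" "norm x = norm w" "(n \<bullet> w)\<^sup>2 < (norm w)\<^sup>2"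
      using circ that c by simp_all
    from rot_exists[OF n this] show ?thesis by metis
  qed
  have partner: "(x = rot n \<alpha> w \<or> x = rot n (-\<alpha>) w) \<and> 0 \<le> \<alpha> \<and> \<alpha> \<le> pi \<and> 1 - cos \<alpha> = d\<^sup>2 / (2 * (1 - c\<^sup>2))"
    if wx: "w \<in> V" "x \<in> V" "dist w x = d" for w x
  proof -
    obtain t where t: "-pi < t" "t \<le> pi" "x = rot n t w" using angle wx by blast
    have "cos t = 1 - d\<^sup>2 / (2 * (1 - c\<^sup>2))"
      using chord[OF wx(1), of t] wx(3) t(3) c by (simp add: field_simps)
    then have "\<bar>t\<bar> = \<alpha>"
      using t unfolding \<alpha>_def by (metis abs_ge_zero abs_le_iff arccos_cos cos_abs_real less_imp_le minus_le_iff)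
    then show ?thesis using t \<open>cos t = _\<close> by (auto simp: abs_if split: if_splits)
  qed
  \<comment> \<open>Only two points of the circle are candidates for distance \<open>d\<close> from
    \<open>w\<close>. Since \<open>nb\<close> provides two distinct such points of \<open>V\<close>,
    both candidates belong to \<open>V\<close>.\<close>
  have two: "rot n \<alpha> w \<in> V \<and> rot n (-\<alpha>) w \<in> V \<and> rot n \<alpha> w \<noteq> rot n (-\<alpha>) w \<and>
      (\<exists>a. n \<times> a \<noteq> 0 \<and> a \<bullet> rot n \<alpha> w = a \<bullet> w \<and> (\<forall>z\<in>V. a \<bullet> z \<le> a \<bullet> w))" if w: "w \<in> V" for w
  proof -
    obtain w1 w2 where "w1 \<in> V" "w2 \<in> V" "w1 \<noteq> w2"
      and *: "\<forall>x\<in>{w1,w2}. dist w x = d \<and> (\<exists>a. n \<times> a \<noteq> 0 \<and> a \<bullet> x = a \<bullet> w \<and> (\<forall>z\<in>V. a \<bullet> z \<le> a \<bullet> w))"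
      using nb[OF w] by blast
    then have "w1 = rot n \<alpha> w \<and> w2 = rot n (-\<alpha>) w \<or> w2 = rot n \<alpha> w \<and> w1 = rot n (-\<alpha>) w"
      using partner[OF w] by (metis insert_iff)
    then show ?thesis using * \<open>w1 \<in> V\<close> \<open>w2 \<in> V\<close> \<open>w1 \<noteq> w2\<close> by (metis insert_iff)
  qed
  obtain w0 where w0: "w0 \<in> V" using ne by blast
  obtain w0' where w0': "w0' \<in> V" "dist w0 w0' = d" using nb[OF w0] by blast
  have \<alpha>d: "1 - cos \<alpha> = d\<^sup>2 / (2 * (1 - c\<^sup>2))" and "0 \<le> \<alpha>" "\<alpha> \<le> pi"
    using partner[OF w0 w0'] by auto
  have "\<alpha> \<noteq> 0" using \<alpha>d d c by auto
  \<comment> \<open>At a half turn the two candidates would coincide.\<close>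
  moreover have "\<alpha> \<noteq> pi" using two[OF w0] rot_periodic(2)[of n pi w0] by auto
  ultimately have \<alpha>: "0 < \<alpha>" "\<alpha> < pi" using \<open>0 \<le> \<alpha>\<close> \<open>\<alpha> \<le> pi\<close> by auto
  have empty: "s = 0" if w: "w \<in> V" and s: "0 \<le> s" "s < \<alpha>" "rot n s w \<in> V" for w s
  proof (rule ccontr)
    assume "s \<noteq> 0"
    then have "0 < s" using s by simp
    obtain a where a: "n \<times> a \<noteq> 0" "a \<bullet> rot n \<alpha> w = a \<bullet> w" "\<forall>z\<in>V. a \<bullet> z \<le> a \<bullet> w"
      using two[OF w] by blast
    \<comment> \<open>Along the circle, \<open>a\<close> is a sinusoid with coefficients
      \<open>A\<close> and \<open>B\<close>. Equality at the angle \<alpha> ties \<open>A\<close> to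
      \<open>B\<close>, and the point of \<open>V\<close> at the opposite angle gives
      \<open>B\<close> its sign. A point strictly between would then violate the support
      inequality.\<close>
    define A where "A = a \<bullet> (w - (n \<bullet> w) *\<^sub>R n)"
    define B where "B = a \<bullet> (n \<times> w)"
    have r: "a \<bullet> rot n t w - a \<bullet> w = A * cos t + B * sin t - A" for t
      by (simp add: inner_rot_gen[OF n] A_def B_def inner_diff_right algebra_simps)
    have 1: "A * (1 - cos \<alpha>) = B * sin \<alpha>" using r[of \<alpha>] a by (simp add: algebra_simps)
    have "a \<bullet> rot n (-\<alpha>) w \<le> a \<bullet> w" using a two[OF w] by blast
    then have 2: "0 \<le> A * (1 - cos \<alpha>) + B * sin \<alpha>" using r[of "-\<alpha>"] by (simp add: algebra_simps)
    have sp: "sin \<alpha> > 0" using \<alpha> by (simp add: sin_gt_zero)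
    have cp: "1 - cos \<alpha> > 0" using cos_less_one[of \<alpha>] \<alpha> by simp
    have "B * sin \<alpha> \<ge> 0" using 1 2 by linarith
    then have "B \<ge> 0" using sp by (simp add: zero_le_mult_iff)
    moreover have "B \<noteq> 0"
    proof
      assume "B = 0"
      then have "A = 0" using 1 cp by simp
      moreover have "(n \<bullet> w)\<^sup>2 < (norm w)\<^sup>2" using circ w c by simp
      ultimately show False
        using axis_if_orthogonal_to_circle[OF n, of w a] a(1) \<open>B = 0\<close> by (simp add: A_def B_def)
    qed
    ultimately have "B > 0" by simp
    have "a \<bullet> rot n s w \<le> a \<bullet> w" using a s by blast
    then have "B * sin s \<le> A * (1 - cos s)" using r[of s] by (simp add: algebra_simps)
    then have "B * sin s * (1 - cos \<alpha>) \<le> A * (1 - cos s) * (1 - cos \<alpha>)"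
      using cp by (intro mult_right_mono) auto
    also have "\<dots> = A * (1 - cos \<alpha>) * (1 - cos s)" by simp
    also have "\<dots> = B * sin \<alpha> * (1 - cos s)" by (simp only: 1)
    finally have "sin s * (1 - cos \<alpha>) \<le> sin \<alpha> * (1 - cos s)"
      using \<open>B > 0\<close> by simp
    then show False using sin_chord_less[OF \<open>0 < s\<close> s(2) \<alpha>(2)] by simp
  qed
  have closed: "rot n (real k * \<alpha>) w \<in> V \<and> rot n (- (real k * \<alpha>)) w \<in> V" if "w \<in> V" for w k
  proof (induction k)
    case 0
    show ?case using that by simp
  next
    case (Suc k)
    have "rot n \<alpha> (rot n (real k * \<alpha>) w) \<in> V" "rot n (-\<alpha>) (rot n (- (real k * \<alpha>)) w) \<in> V"
      using Suc two by blast+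
    then show ?case by (simp add: rot_add n algebra_simps)
  qed
  \<comment> \<open>The number of whole steps in a full turn. The angle left over is smaller than
    \<alpha> and also leads to a point of \<open>V\<close>, so \<open>empty\<close> makes it
    0.\<close>
  define m where "m = nat \<lfloor>2 * pi / \<alpha>\<rfloor>"
  have m: "real m * \<alpha> = 2 * pi"
  proof -
    have "real m = of_int \<lfloor>2 * pi / \<alpha>\<rfloor>" using \<alpha> by (simp add: m_def)
    then have "real m \<le> 2 * pi / \<alpha>" "2 * pi / \<alpha> < real m + 1" by linarith+
    then have le: "real m * \<alpha> \<le> 2 * pi" "2 * pi < real m * \<alpha> + \<alpha>"
      using \<alpha> by (auto simp: field_simps)
    have "rot n (- (real m * \<alpha>)) w0 \<in> V" using closed w0 by blast
    then have "rot n (2 * pi - real m * \<alpha>) w0 \<in> V"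
      using rot_periodic(1)[of n "- (real m * \<alpha>)" w0] by (simp add: algebra_simps)
    then have "2 * pi - real m * \<alpha> = 0" using le by (intro empty[OF w0]) auto
    then show ?thesis by simp
  qed
  have orbit: "V = (\<lambda>k. rot n (real k * \<alpha>) w) ` {..<m}" if w: "w \<in> V" for w
  proof
    show "(\<lambda>k. rot n (real k * \<alpha>) w) ` {..<m} \<subseteq> V" using closed[OF w] by blast
    show "V \<subseteq> (\<lambda>k. rot n (real k * \<alpha>) w) ` {..<m}"
    proof
      fix z assume z: "z \<in> V"
      obtain t0 where t0: "-pi < t0" "t0 \<le> pi" "z = rot n t0 w" using angle[OF w z] by blast
      obtain t where t: "0 \<le> t" "t < 2 * pi" "z = rot n t w"
      proof (cases "0 \<le> t0")
        case True
        show ?thesis by (rule that[of t0]) (use t0 True pi_gt_zero in linarith)+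
      next
        case False
        show ?thesis by (rule that[of "t0 + 2 * pi"]) (use t0 False in \<open>auto simp: rot_periodic\<close>)
      qed
      \<comment> \<open>Rounding down to a multiple of \<alpha> leaves a rest that
        \<open>empty\<close> makes 0.\<close>
      define k where "k = nat \<lfloor>t / \<alpha>\<rfloor>"
      have "real k = of_int \<lfloor>t / \<alpha>\<rfloor>" using \<alpha> t by (simp add: k_def)
      then have "real k \<le> t / \<alpha>" "t / \<alpha> < real k + 1" by linarith+
      then have le: "real k * \<alpha> \<le> t" "t < real k * \<alpha> + \<alpha>"
        using \<alpha> by (auto simp: field_simps)
      have "rot n (- (real k * \<alpha>)) z \<in> V" using closed[OF z] by blast
      then have "rot n (t - real k * \<alpha>) w \<in> V" by (simp add: t rot_add n)
      then have "t - real k * \<alpha> = 0" using le by (intro empty[OF w]) auto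
      then have "t = real k * \<alpha>" by simp
      moreover have "k < m"
      proof -
        have "real k * \<alpha> < real m * \<alpha>" using \<open>t = _\<close> t m by simp
        then show ?thesis using \<alpha> by simp
      qed
      ultimately show "z \<in> (\<lambda>k. rot n (real k * \<alpha>) w) ` {..<m}" using t by blast
    qed
  qed
  \<comment> \<open>Two equal points of the orbit would give a chord of length 0 for an angle
    strictly between 0 and a full turn. Injectivity identifies \<open>m\<close> with
    \<open>card V\<close>.\<close>
  have "inj_on (\<lambda>k. rot n (real k * \<alpha>) w0) {..<m}"
  proof (rule linorder_inj_onI)
    fix i j assume ij: "i < j" "i \<in> {..<m}" "j \<in> {..<m}"
    show "rot n (real i * \<alpha>) w0 \<noteq> rot n (real j * \<alpha>) w0"
    proof
      assume "rot n (real i * \<alpha>) w0 = rot n (real j * \<alpha>) w0"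
      then have "rot n (- (real i * \<alpha>)) (rot n (real i * \<alpha>) w0) = rot n (- (real i * \<alpha>)) (rot n (real j * \<alpha>) w0)"
        by simp
      then have "w0 = rot n (real (j - i) * \<alpha>) w0"
        using ij by (simp add: rot_add n of_nat_diff algebra_simps)
      then have "cos (real (j - i) * \<alpha>) = 1"
        using chord[OF w0, of "real (j - i) * \<alpha>"] c by simp
      moreover have "0 < real (j - i) * \<alpha>" using ij \<alpha> by simp
      moreover have "real (j - i) * \<alpha> < real m * \<alpha>" using ij \<alpha> by simp
      ultimately show False using cos_less_one[of "real (j - i) * \<alpha>"] m by (metis less_irrefl)
    qed
  qed auto
  then have "card V = m" using orbit[OF w0] by (metis card_image card_lessThan)
  moreover have "m > 0" using m by (metis gr0I mult_eq_0_iff of_nat_0 pi_neq_zero zero_neq_numeral)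
  ultimately have "\<alpha> = 2 * pi / real (card V)" using m by (simp add: field_simps)
  moreover have "d\<^sup>2 = 2 * (1 - c\<^sup>2) * (1 - cos \<alpha>)" using \<alpha>d c by (simp add: field_simps)
  ultimately show ?thesis
    using \<alpha> c orbit partner two \<open>card V = m\<close> by (intro that[of \<alpha>]) blast+
qed

subsection \<open>Rotational symmetry of regular polyhedra\<close>

text \<open>A proper nonempty face is the intersection of the facets that contain it. With a single
  such facet the face would equal it, against \<open>dim\<close>. It serves for a vertex of a
  polygon and for an edge of the polyhedron.\<close>

lemma polyhedron_face_in_two_facets:
  fixes Q :: "'a::euclidean_space set"
  assumes Q: "polyhedron Q" and C: "C face_of Q" "C \<noteq> {}" and dim: "aff_dim C + 2 \<le> aff_dim Q"
  obtains F1 F2 where "F1 facet_of Q" "F2 facet_of Q" "F1 \<noteq> F2" "C \<subseteq> F1" "C \<subseteq> F2"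
proof -
  have "C \<noteq> Q" using dim by auto
  then have eq: "C = \<Inter>{F. F facet_of Q \<and> C \<subseteq> F}"
    by (intro face_of_polyhedron Q C)
  have "{F. F facet_of Q \<and> C \<subseteq> F} \<noteq> {}"
  proof
    assume "{F. F facet_of Q \<and> C \<subseteq> F} = {}"
    then have "C = UNIV" using eq by (metis Inter_empty)
    then show False using \<open>C \<noteq> Q\<close> face_of_imp_subset[OF C(1)] by auto
  qed
  then obtain F1 where F1: "F1 facet_of Q" "C \<subseteq> F1" by blast
  have "\<exists>F2. F2 facet_of Q \<and> C \<subseteq> F2 \<and> F2 \<noteq> F1"
  proof (rule ccontr)
    assume "\<not> ?thesis"
    then have "{F. F facet_of Q \<and> C \<subseteq> F} = {F1}" using F1 by blast
    then have "C = F1" using eq by simp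
    then show False using F1 dim by (simp add: facet_of_def)
  qed
  then show ?thesis using F1 that by blast
qed

section \<open>Vertices, edges and facets of an inscribed polyhedron\<close>

locale inscribed_regular_polyhedron =
  fixes p q :: nat and S :: "(real^3) set"
  assumes p: "p \<ge> 3" and q: "q \<ge> 3"
    and regular: "regular_polyhedron_vertices p q S"
    and norm_vertex: "v \<in> S \<Longrightarrow> norm v = 1"
begin

abbreviation P :: "(real^3) set" where "P \<equiv> convex hull S"

definition facets :: "(real^3) set set" where
  "facets = {F. F face_of P \<and> aff_dim F = 2}"

text \<open>Distinctness matters, as the degenerate segment at a vertex is a face as well.\<close>

definition adj :: "real^3 \<Rightarrow> real^3 \<Rightarrow> bool" where
  "adj v w \<longleftrightarrow> v \<noteq> w \<and> closed_segment v w face_of P"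

lemma finite_S: "finite S" and aff_dim_P: "aff_dim P = 3"
  and extreme_P: "v extreme_point_of P \<longleftrightarrow> v \<in> S"
  and facet_polygon: "F \<in> facets \<Longrightarrow> regular_polygon p F"
  and card_facets_at: "v \<in> S \<Longrightarrow> card {F \<in> facets. v \<in> F} = q"
  using regular by (auto simp: regular_polyhedron_vertices_def vertices_of_def facets_def conj_assoc)

lemma polytope_P: "polytope P" and polyhedron_P: "polyhedron P"
  and convex_P: "convex P" and bounded_P: "bounded P"
  using finite_S polytope_convex_hull polytope_imp_polyhedron polytope_imp_bounded by blast+

lemma facet_of_P: "F facet_of P \<longleftrightarrow> F \<in> facets"
  by (auto simp: facets_def facet_of_def aff_dim_P)

lemma facetD:
  assumes "F \<in> facets"
  shows "F face_of P" "F \<subseteq> P" "aff_dim F = 2" "convex F" "polyhedron F" "F \<noteq> {}"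
proof -
  show F: "F face_of P" "aff_dim F = 2" using assms by (auto simp: facets_def)
  show "F \<subseteq> P" "convex F" "polyhedron F" "F \<noteq> {}"
    using F face_of_imp_subset face_of_imp_convex face_of_polytope_polytope[OF polytope_P F(1)]
      polytope_imp_polyhedron by auto
qed

lemma extreme_facet: "F \<in> facets \<Longrightarrow> v extreme_point_of F \<longleftrightarrow> v \<in> S \<and> v \<in> F"
  using extreme_point_of_face[OF facetD(1)] extreme_P by blast

lemma card_facet_vertices: "F \<in> facets \<Longrightarrow> card (S \<inter> F) = p"
  using facet_polygon[of F] extreme_facet[of F]
  by (simp add: regular_polygon_def vertices_of_def Int_def)

lemma adj_sym: "adj v w \<Longrightarrow> adj w v"
  by (simp add: adj_def closed_segment_commute eq_commute)

lemma adj_vertices: assumes "adj v w" shows "v \<in> S" "w \<in> S"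
proof -
  have "closed_segment v w face_of P" using assms by (simp add: adj_def)
  from extreme_point_of_face[OF this] show "v \<in> S" "w \<in> S"
    unfolding extreme_P extreme_point_of_segment by blast+
qed

lemma vertex_in_edge:
  assumes "closed_segment a b face_of P" "v \<in> S" "v \<in> closed_segment a b"
  shows "v = a \<or> v = b"
  using extreme_point_of_face[OF assms(1), of v] extreme_P assms by (simp add: extreme_point_of_segment)

text \<open>The equal-length clause of \<open>regular_polygon\<close> also provides the end points,
  and the dimension keeps them distinct.\<close>

lemma edge_is_segment:
  assumes F: "F \<in> facets" and G: "G face_of F" "aff_dim G = 1"
  shows "\<exists>v w. adj v w \<and> G = closed_segment v w"
proof -
  obtain a b where ab: "G = closed_segment a b"
    using facet_polygon[OF F] G unfolding regular_polygon_def by blast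
  have "a \<noteq> b"
  proof
    assume "a = b"
    then show False using G(2) by (simp add: ab)
  qed
  moreover have "G face_of P" using face_of_trans[OF G(1) facetD(1)[OF F]] .
  ultimately have "adj a b" by (simp add: adj_def ab)
  then show ?thesis using ab by blast
qed

lemma aff_dim_segment: "v \<noteq> w \<Longrightarrow> aff_dim (closed_segment v w) = 1" for v w :: "real^3"
  by (simp add: segment_convex_hull aff_dim_convex_hull aff_dim_2)

lemma edge_face_of_facet:
  assumes "F \<in> facets" "adj v w" "v \<in> F" "w \<in> F"
  shows "closed_segment v w face_of F"
proof (rule face_of_subset)
  show "closed_segment v w face_of P" using assms by (simp add: adj_def)
  show "closed_segment v w \<subseteq> F" using assms facetD(4) by (simp add: closed_segment_subset)
  show "F \<subseteq> P" using assms facetD(2) by simp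
qed

lemma facet_edge_length:
  assumes F: "F \<in> facets"
  shows "\<exists>l. \<forall>v w. adj v w \<and> v \<in> F \<and> w \<in> F \<longrightarrow> dist v w = l"
proof -
  obtain l where l: "\<And>e. e face_of F \<and> aff_dim e = 1 \<Longrightarrow> \<exists>a b. e = closed_segment a b \<and> dist a b = l"
    using facet_polygon[OF F] unfolding regular_polygon_def by blast
  have "dist v w = l" if vw: "adj v w" "v \<in> F" "w \<in> F" for v w
  proof -
    obtain a b where "closed_segment v w = closed_segment a b" "dist a b = l"
      using l[of "closed_segment v w"] edge_face_of_facet[OF F vw] aff_dim_segment[of v w] vw
      by (auto simp: adj_def)
    then have "{v, w} = {a, b}" by (metis closed_segment_eq)
    then show ?thesis using \<open>dist a b = l\<close> by (metis doubleton_eq_iff dist_commute)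
  qed
  then show ?thesis by (intro exI[of _ l]) simp
qed

text \<open>A vertex has codimension two in its polygon, hence lies on two edges, and it must be an
  end point of each.\<close>

lemma facet_two_neighbours:
  assumes F: "F \<in> facets" and v: "v \<in> S" "v \<in> F"
  obtains w1 w2 where "w1 \<noteq> w2" "adj v w1" "adj v w2" "w1 \<in> F" "w2 \<in> F"
proof -
  have "{v} face_of F" using extreme_facet[OF F] v by (simp add: face_of_singleton)
  then obtain e1 e2 where e: "e1 facet_of F" "e2 facet_of F" "e1 \<noteq> e2" "v \<in> e1" "v \<in> e2"
    using polyhedron_face_in_two_facets[OF facetD(5)[OF F], of "{v}"] facetD[OF F] by auto
  have *: "\<exists>w. adj v w \<and> w \<in> F \<and> e = closed_segment v w" if e: "e facet_of F" "v \<in> e" for e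
  proof -
    have eF: "e face_of F" "aff_dim e = 1" using e facetD[OF F] by (auto simp: facet_of_def)
    then obtain a b where ab: "adj a b" "e = closed_segment a b" using edge_is_segment[OF F] by blast
    have "v = a \<or> v = b" using vertex_in_edge[of a b v] ab v e by (auto simp: adj_def)
    moreover have "a \<in> F" "b \<in> F" using face_of_imp_subset[OF eF(1)] ab by auto
    ultimately show ?thesis using ab adj_sym closed_segment_commute by blast
  qed
  show ?thesis using *[OF e(1,4)] *[OF e(2,5)] e(3) that by metis
qed

lemma edge_two_facets:
  assumes "adj v w"
  obtains F1 F2 where "F1 \<in> facets" "F2 \<in> facets" "F1 \<noteq> F2" "v \<in> F1" "w \<in> F1" "v \<in> F2" "w \<in> F2"
proof -
  have "closed_segment v w face_of P" "aff_dim (closed_segment v w) + 2 \<le> aff_dim P"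
    using assms aff_dim_segment[of v w] by (auto simp: adj_def aff_dim_P)
  from polyhedron_face_in_two_facets[OF polyhedron_P this(1) _ this(2)]
  obtain F1 F2 where "F1 facet_of P" "F2 facet_of P" "F1 \<noteq> F2"
    "closed_segment v w \<subseteq> F1" "closed_segment v w \<subseteq> F2" by auto
  then show ?thesis using that[of F1 F2] by (auto simp: facet_of_P)
qed

lemma edge_in_facet: "adj v w \<Longrightarrow> \<exists>F\<in>facets. v \<in> F \<and> w \<in> F"
  by (erule edge_two_facets) blast

lemma facet_normal:
  assumes F: "F \<in> facets"
  obtains n c where "norm n = 1" "\<And>x. x \<in> P \<Longrightarrow> n \<bullet> x \<le> c" "F = P \<inter> {x. n \<bullet> x = c}"
proof -
  have "F exposed_face_of P"
    using exposed_face_of_polyhedron[OF polyhedron_P] facetD[OF F] by simp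
  then obtain a b where ab: "P \<subseteq> {x. a \<bullet> x \<le> b}" "F = P \<inter> {x. a \<bullet> x = b}"
    by (auto simp: exposed_face_of_def)
  have "a \<noteq> 0"
  proof
    assume "a = 0"
    then have "F = P \<or> F = {}" using ab by auto
    then show False using facetD[OF F] aff_dim_P by auto
  qed
  show ?thesis
  proof (rule that[of "(1 / norm a) *\<^sub>R a" "b / norm a"])
    show "norm ((1 / norm a) *\<^sub>R a) = 1" using \<open>a \<noteq> 0\<close> by simp
    show "F = P \<inter> {x. ((1 / norm a) *\<^sub>R a) \<bullet> x = b / norm a}"
      using ab(2) \<open>a \<noteq> 0\<close> by (simp add: field_simps)
    show "\<And>x. x \<in> P \<Longrightarrow> ((1 / norm a) *\<^sub>R a) \<bullet> x \<le> b / norm a"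
      using ab(1) \<open>a \<noteq> 0\<close> by (auto simp: divide_right_mono)
  qed
qed

text \<open>The intersection is a face of both facets and proper in at least one of them, which
  leaves only the dimensions 0 and 1.\<close>

lemma facet_meet:
  assumes F: "F \<in> facets" "F' \<in> facets" "F \<noteq> F'" and x: "x \<in> F" "x \<in> F'"
  shows "F \<inter> F' = {x} \<and> x \<in> S \<or> (\<exists>v w. adj v w \<and> F \<inter> F' = closed_segment v w)"
proof -
  define G where "G = F \<inter> F'"
  have GP: "G face_of P" 
    unfolding G_def by (intro face_of_Int facetD F)
  have GF: "G face_of F" "G face_of F'"
    using face_of_subset[OF GP _ facetD(2)[OF F(1)]] face_of_subset[OF GP _ facetD(2)[OF F(2)]]
    by (auto simp: G_def)
  have "G \<noteq> F \<or> G \<noteq> F'" using F by auto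
  then have "aff_dim G < 2"
    using face_of_aff_dim_lt[OF facetD(4)[OF F(1)] GF(1)] face_of_aff_dim_lt[OF facetD(4)[OF F(2)] GF(2)]
      facetD[OF F(1)] facetD[OF F(2)] by auto
  moreover have "aff_dim G \<ge> 0" 
    using x aff_dim_geq[of G] aff_dim_empty[of G] by (auto simp: G_def)
  ultimately consider "aff_dim G = 0" | "aff_dim G = 1" by linarith
  then show ?thesis
  proof cases
    case 1
    then obtain y where "G = {y}" by (auto simp: aff_dim_eq_0)
    then have "G = {x}" using x by (auto simp: G_def)
    then show ?thesis using GP extreme_P by (auto simp: G_def face_of_singleton)
  next
    case 2
    then show ?thesis using edge_is_segment[OF F(1) GF(1)] by (auto simp: G_def)
  qed
qed

text \<open>By \<open>facet_meet\<close>, distinct facets share at most the two end points of one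
  edge.\<close>

lemma facet_eqI:
  assumes F: "F \<in> facets" "F' \<in> facets" and "u \<in> S" "v \<in> S" "w \<in> S" "u \<noteq> v" "u \<noteq> w" "v \<noteq> w"
    "u \<in> F" "u \<in> F'" "v \<in> F" "v \<in> F'" "w \<in> F" "w \<in> F'"
  shows "F = F'"
proof (rule ccontr)
  assume "F \<noteq> F'"
  moreover have "F \<inter> F' \<noteq> {u}" 
    using assms by (metis Int_iff singletonD)
  ultimately obtain a b where ab: "adj a b" "F \<inter> F' = closed_segment a b"
    using facet_meet[OF F \<open>F \<noteq> F'\<close>, of u] assms by metis
  then have "u = a \<or> u = b" "v = a \<or> v = b" "w = a \<or> w = b"
    using vertex_in_edge[of a b] assms by (auto simp: adj_def)
  then show False using assms by auto
qed

section \<open>The vertices of one facet\<close>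

text \<open>The plane of the facet cuts the unit sphere in a circle, and the edges are supporting
  chords of one length, so \<open>circle_orbit\<close> applies with the facet normal as axis. The
  last conclusion expresses the diagonal between the two neighbours of a vertex through
  \<open>l\<close> and \<open>p\<close> alone.\<close>

lemma facet_structure:
  assumes F: "F \<in> facets"
  obtains n l where "norm n = 1" "l > 0"
    "\<And>v w. \<lbrakk>adj v w; v \<in> F; w \<in> F\<rbrakk> \<Longrightarrow> dist v w = l"
    "\<And>v. v \<in> S \<inter> F \<Longrightarrow> S \<inter> F = (\<lambda>k. rot n (real k * (2 * pi / p)) v) ` {..<p}"
    "\<And>v. v \<in> S \<inter> F \<Longrightarrow> {w \<in> F. adj v w} = {rot n (2 * pi / p) v, rot n (- (2 * pi / p)) v}"
    "\<And>v. v \<in> S \<inter> F \<Longrightarrow> rot n (2 * pi / p) v \<noteq> rot n (- (2 * pi / p)) v"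
    "\<And>v. v \<in> S \<inter> F \<Longrightarrow>
       (dist (rot n (2 * pi / p) v) (rot n (- (2 * pi / p)) v))\<^sup>2 = 2 * l\<^sup>2 * (1 + cos (2 * pi / p))"
proof -
  obtain n c where n: "norm n = 1" and Fn: "F = P \<inter> {x. n \<bullet> x = c}"
    using facet_normal[OF F] by blast
  obtain l where l: "\<And>v w. adj v w \<and> v \<in> F \<and> w \<in> F \<Longrightarrow> dist v w = l"
    using facet_edge_length[OF F] by blast
  have ne: "S \<inter> F \<noteq> {}" using card_facet_vertices[OF F] p by auto
  then obtain v0 where v0: "v0 \<in> S \<inter> F" by blast
  obtain w0 where "adj v0 w0" "w0 \<in> F" using facet_two_neighbours[OF F, of v0] v0 by blast
  then have "l > 0" using l[of v0 w0] v0 by (auto simp: adj_def)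
  \<comment> \<open>A functional that exposes the edge in \<open>P\<close> supports the chord. Were
    it parallel to \<open>n\<close>, it would be constant on \<open>F\<close>, and the facet would
    be contained in an edge.\<close>
  have supp: "\<exists>a. n \<times> a \<noteq> 0 \<and> a \<bullet> x = a \<bullet> w \<and> (\<forall>z\<in>S \<inter> F. a \<bullet> z \<le> a \<bullet> w)"
    if wx: "adj w x" "w \<in> F" "x \<in> F" for w x
  proof -
    have "closed_segment w x exposed_face_of P"
      using exposed_face_of_polyhedron[OF polyhedron_P] wx by (simp add: adj_def)
    then obtain a b where ab: "P \<subseteq> {x. a \<bullet> x \<le> b}" "closed_segment w x = P \<inter> {x. a \<bullet> x = b}"
      by (auto simp: exposed_face_of_def)
    have awx: "a \<bullet> w = b" "a \<bullet> x = b" using ab(2) ends_in_segment by blast+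
    have "n \<times> a \<noteq> 0"
    proof
      assume "n \<times> a = 0"
      then have "a = (n \<bullet> a) *\<^sub>R n" using cross_cross_unit[OF n, of a] by simp
      then have const: "a \<bullet> z = (n \<bullet> a) * c" if "z \<in> F" for z
        using that Fn by (metis (mono_tags, lifting) Int_iff inner_scaleR_left mem_Collect_eq)
      then have "F \<subseteq> closed_segment w x"
        using ab(2) awx wx facetD(2)[OF F] by force
      then have "aff_dim F \<le> aff_dim (closed_segment w x)" by (rule aff_dim_subset)
      then show False using facetD[OF F] aff_dim_segment[of w x] wx by (auto simp: adj_def)
    qed
    moreover have "\<forall>z\<in>S \<inter> F. a \<bullet> z \<le> a \<bullet> w" using ab(1) awx facetD(2)[OF F] by auto
    ultimately show ?thesis using awx by auto
  qed
  have "\<exists>w1\<in>S \<inter> F. \<exists>w2\<in>S \<inter> F. w1 \<noteq> w2 \<and> (\<forall>x\<in>{w1,w2}. dist w x = l \<and>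
               (\<exists>a. n \<times> a \<noteq> 0 \<and> a \<bullet> x = a \<bullet> w \<and> (\<forall>z\<in>S \<inter> F. a \<bullet> z \<le> a \<bullet> w)))" if w: "w \<in> S \<inter> F" for w
  proof -
    obtain w1 w2 where "w1 \<noteq> w2" "adj w w1" "adj w w2" "w1 \<in> F" "w2 \<in> F"
      using facet_two_neighbours[OF F, of w] w by blast
    moreover from this have "w1 \<in> S" "w2 \<in> S" using adj_vertices by auto
    ultimately show ?thesis using l supp w
      by (intro bexI[of _ w1] bexI[of _ w2] conjI) auto
  qed
  from circle_orbit[OF n ne _ _ \<open>l > 0\<close> this, of c]
  obtain \<alpha> where \<alpha>: "0 < \<alpha>" "\<alpha> < pi" "\<alpha> = 2 * pi / real (card (S \<inter> F))"
    and c: "c\<^sup>2 < 1" and l2: "l\<^sup>2 = 2 * (1 - c\<^sup>2) * (1 - cos \<alpha>)"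
    and orbit: "\<And>w. w \<in> S \<inter> F \<Longrightarrow> S \<inter> F = (\<lambda>k. rot n (real k * \<alpha>) w) ` {..<card (S \<inter> F)}"
    and part: "\<And>w x. \<lbrakk>w \<in> S \<inter> F; x \<in> S \<inter> F; dist w x = l\<rbrakk> \<Longrightarrow> x = rot n \<alpha> w \<or> x = rot n (-\<alpha>) w"
    and neq: "\<And>w. w \<in> S \<inter> F \<Longrightarrow> rot n \<alpha> w \<noteq> rot n (-\<alpha>) w"
    using norm_vertex Fn by (smt (verit) Int_iff mem_Collect_eq)
  have \<alpha>p: "\<alpha> = 2 * pi / p" using \<alpha>(3) card_facet_vertices[OF F] by simp
  have nbs: "{w \<in> F. adj v w} = {rot n \<alpha> v, rot n (-\<alpha>) v}" if v: "v \<in> S \<inter> F" for v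
  proof -
    have *: "w = rot n \<alpha> v \<or> w = rot n (-\<alpha>) v" if "adj v w" "w \<in> F" for w
      using part[of v w] l[of v w] that v adj_vertices by blast
    obtain w1 w2 where "w1 \<noteq> w2" "adj v w1" "adj v w2" "w1 \<in> F" "w2 \<in> F"
      using facet_two_neighbours[OF F, of v] v by blast
    then show ?thesis using *[of w1] *[of w2] * by auto
  qed
  \<comment> \<open>The diagonal is the chord of angle \<open>2 * \<alpha>\<close>, and
    \<open>1 - cos (2 * \<alpha>)\<close> contains the factor \<open>1 - cos \<alpha>\<close> of the
    edge length.\<close>
  have diag: "(dist (rot n \<alpha> v) (rot n (-\<alpha>) v))\<^sup>2 = 2 * l\<^sup>2 * (1 + cos \<alpha>)" if v: "v \<in> S \<inter> F" for v
  proof -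
    have "n \<bullet> v = c" "norm v = 1" using v Fn norm_vertex by auto
    have "(dist (rot n (-\<alpha>) v) (rot n (2 * \<alpha>) (rot n (-\<alpha>) v)))\<^sup>2 = 2 * (1 - c\<^sup>2) * (1 - cos (2 * \<alpha>))"
      by (simp add: dist_rot n norm_rot inner_rot_axis \<open>n \<bullet> v = c\<close> \<open>norm v = 1\<close>)
    also have "rot n (2 * \<alpha>) (rot n (-\<alpha>) v) = rot n \<alpha> v" by (simp add: rot_add n)
    also have "2 * (1 - c\<^sup>2) * (1 - cos (2 * \<alpha>)) = 2 * l\<^sup>2 * (1 + cos \<alpha>)"
      unfolding l2 cos_double_cos by (simp add: power2_eq_square algebra_simps)
    finally show ?thesis by (simp add: dist_commute)
  qed
  show ?thesis
    using orbit nbs neq diag l unfolding \<alpha>p card_facet_vertices[OF F]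
    by (intro that[OF n \<open>l > 0\<close>]) simp_all
qed

section \<open>Connectedness of the boundary through edges\<close>

lemma vertices_in_boundary: "S \<subseteq> rel_frontier P"
proof
  fix v assume "v \<in> S"
  then have "{v} face_of P" using extreme_P by (simp add: face_of_singleton)
  moreover have "{v} \<noteq> P" using aff_dim_P by (metis aff_dim_sing zero_neq_numeral)
  ultimately show "v \<in> rel_frontier P"
    using face_of_subset_rel_frontier by blast
qed

text \<open>The boundary is a topological sphere. Punctured at one vertex it is homeomorphic to a
  plane, here the coordinate plane \<open>T\<close>, and a plane stays connected when finitely many
  points are removed.\<close>

lemma connected_boundary_minus_vertices: "connected (rel_frontier P - S)"
proof -
  obtain v where v: "v \<in> S"
    using aff_dim_P by (cases "S = {}") auto
  define T where "T = {x :: real^3. axis 1 1 \<bullet> x = 0}"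
  have T: "affine T" "aff_dim T = 2" "convex T"
    unfolding T_def by (simp_all add: affine_hyperplane convex_hyperplane aff_dim_hyperplane axis_eq_0_iff)
  have "rel_frontier P - {v} homeomorphic T"
    using v vertices_in_boundary
    by (intro homeomorphic_punctured_sphere_affine_gen convex_P bounded_P T) (auto simp: T aff_dim_P)
  then obtain f g where fg: "homeomorphism (rel_frontier P - {v}) T f g"
    by (auto simp: homeomorphic_def)
  define K where "K = f ` (S - {v})"
  have "connected (T - K)"
  proof (rule connected_openin_diff_countable)
    show "connected T" using T by (simp add: convex_connected)
    show "openin (top_of_set (affine hull T)) T" using T by (simp add: affine_hull_eq[THEN iffD2])
    show "\<not> collinear T" using T by (simp add: collinear_aff_dim)
    show "countable K" using finite_S by (simp add: K_def countable_finite)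
  qed
  moreover have "continuous_on (T - K) g"
    using fg continuous_on_subset by (metis Diff_subset homeomorphism_cont2)
  ultimately have "connected (g ` (T - K))" by (rule connected_continuous_image[rotated])
  moreover have "g ` (T - K) = rel_frontier P - S"
  proof
    show "g ` (T - K) \<subseteq> rel_frontier P - S"
    proof
      fix x assume "x \<in> g ` (T - K)"
      then obtain y where y: "y \<in> T" "y \<notin> K" "x = g y" by blast
      then have "x \<in> rel_frontier P - {v}" "f x = y"
        using homeomorphism_apply2[OF fg] homeomorphism_image2[OF fg] by blast+
      then show "x \<in> rel_frontier P - S" using y unfolding K_def by (metis DiffD1 DiffD2 DiffI image_eqI)
    qed
    show "rel_frontier P - S \<subseteq> g ` (T - K)"
    proof
      fix x assume x: "x \<in> rel_frontier P - S"
      then have x': "x \<in> rel_frontier P - {v}" using v by auto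
      then have fx: "f x \<in> T" "g (f x) = x"
        using homeomorphism_apply1[OF fg] homeomorphism_image1[OF fg] by blast+
      moreover have "f x \<notin> K"
      proof
        assume "f x \<in> K"
        then obtain u where "u \<in> S - {v}" "f x = f u"
          unfolding K_def by (rule imageE)
        then have u: "u \<in> S" "u \<noteq> v" "f u = f x" by simp_all
        then have "u \<in> rel_frontier P - {v}" using vertices_in_boundary by blast
        then have "g (f u) = u" using homeomorphism_apply1[OF fg] by blast
        then show False using u fx x by auto
      qed
      ultimately show "x \<in> g ` (T - K)" by force
    qed
  qed
  ultimately show ?thesis by simp
qed

lemma finite_facets: "finite facets"
  using finite_polytope_faces[OF polytope_P] by (rule finite_subset[rotated]) (auto simp: facets_def)

lemma closed_facet: "F \<in> facets \<Longrightarrow> closed F"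
  using facetD(5) polyhedron_imp_closed by blast

text \<open>A finite connected set has at most one point, whereas a facet has dimension 2. In
  \<open>facet_induct\<close> this keeps both closed pieces nonempty after the vertices are
  removed.\<close>

lemma facet_not_subset_vertices: "F \<in> facets \<Longrightarrow> \<exists>x\<in>F. x \<notin> S"
proof (rule ccontr)
  assume F: "F \<in> facets" and "\<not> (\<exists>x\<in>F. x \<notin> S)"
  then have "finite F" using finite_S by (meson finite_subset subsetI)
  moreover have "connected F" using facetD[OF F] convex_connected by blast
  ultimately obtain x where "F = {x}" using facetD[OF F] connected_finite_iff_sing by auto
  then show False using facetD[OF F] by simp
qed

text \<open>Facets of \<open>\<A>\<close> and the other facets meet in vertices only, so without the vertices
  they would disconnect the boundary.\<close>

lemma facet_induct:
  assumes sub: "\<A> \<subseteq> facets" and ne: "\<A> \<noteq> {}"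
    and step: "\<And>F F' v w. \<lbrakk>F \<in> \<A>; F' \<in> facets; adj v w; v \<in> F; w \<in> F; v \<in> F'; w \<in> F'\<rbrakk> \<Longrightarrow> F' \<in> \<A>"
  shows "\<A> = facets"
proof (rule ccontr)
  assume "\<A> \<noteq> facets"
  then obtain F' where F': "F' \<in> facets - \<A>" using sub by blast
  obtain F where F: "F \<in> \<A>" using ne by blast
  define A where "A = \<Union>\<A>"
  define B where "B = \<Union>(facets - \<A>)"
  have fr: "rel_frontier P = \<Union>facets"
    by (simp add: rel_frontier_of_polyhedron[OF polyhedron_P] facet_of_P)
  have "closed A" "closed B"
    unfolding A_def B_def using finite_facets sub closed_facet
    by (auto intro!: closed_Union intro: finite_subset)
  moreover have "rel_frontier P - S \<subseteq> A \<union> B" unfolding fr A_def B_def by blast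
  moreover have "A \<inter> B \<inter> (rel_frontier P - S) = {}"
  proof (rule ccontr)
    assume "A \<inter> B \<inter> (rel_frontier P - S) \<noteq> {}"
    then obtain x F1 F2 where x: "x \<notin> S" "F1 \<in> \<A>" "F2 \<in> facets" "F2 \<notin> \<A>" "x \<in> F1" "x \<in> F2"
      by (auto simp: A_def B_def)
    then obtain v w where vw: "adj v w" "F1 \<inter> F2 = closed_segment v w"
      using facet_meet[of F1 F2 x] sub by blast
    then have "v \<in> F1 \<inter> F2" "w \<in> F1 \<inter> F2" by simp_all
    then show False using step[OF x(2,3) vw(1)] x by blast
  qed
  moreover have "A \<inter> (rel_frontier P - S) \<noteq> {}"
    using facet_not_subset_vertices[of F] F sub unfolding fr A_def by blast
  moreover have "B \<inter> (rel_frontier P - S) \<noteq> {}"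
    using facet_not_subset_vertices[of F'] F' unfolding fr B_def by blast
  ultimately show False
    using connected_boundary_minus_vertices unfolding connected_closed by blast
qed

lemma facet_at_vertex: "v \<in> S \<Longrightarrow> \<exists>F\<in>facets. v \<in> F"
  using card_facets_at[of v] q by (metis (mono_tags, lifting) card.empty empty_Collect_eq not_numeral_le_zero)

lemma neighbour_exists: "v \<in> S \<Longrightarrow> \<exists>w. adj v w"
  using facet_at_vertex facet_two_neighbours by metis

text \<open>All edges of one facet are equally long and adjacent facets share an edge, so
  \<open>facet_induct\<close> carries the length of one edge to all others.\<close>

lemma edge_length:
  obtains l where "l > 0" "\<And>v w. adj v w \<Longrightarrow> dist v w = l"
proof -
  obtain v0 where v0: "v0 \<in> S"
    using aff_dim_P by (cases "S = {}") auto
  obtain w0 where vw0: "adj v0 w0" using neighbour_exists[OF v0] by blast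
  define l where "l = dist v0 w0"
  define \<A> where "\<A> = {F \<in> facets. \<forall>v w. adj v w \<and> v \<in> F \<and> w \<in> F \<longrightarrow> dist v w = l}"
  have good: "F \<in> \<A>" if "F \<in> facets" "adj v w" "v \<in> F" "w \<in> F" "dist v w = l" for F v w
    using facet_edge_length[OF that(1)] that unfolding \<A>_def by (auto; metis)
  have "\<A> = facets"
  proof (rule facet_induct)
    show "\<A> \<subseteq> facets" by (auto simp: \<A>_def)
    show "\<A> \<noteq> {}" using edge_in_facet[OF vw0] good[OF _ vw0] l_def by blast
    show "F' \<in> \<A>" if "F \<in> \<A>" "F' \<in> facets" "adj v w" "v \<in> F" "w \<in> F" "v \<in> F'" "w \<in> F'" for F F' v w
    proof (rule good[OF that(2,3)])
      show "dist v w = l" using that(1,3,4,5) by (simp add: \<A>_def)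
    qed (use that in auto)
  qed
  have "dist v w = l" if vw: "adj v w" for v w
  proof -
    obtain F where "F \<in> facets" "v \<in> F" "w \<in> F" using edge_in_facet[OF vw] by blast
    then show ?thesis using vw \<open>\<A> = facets\<close> unfolding \<A>_def by blast
  qed
  moreover have "l > 0" using vw0 by (auto simp: l_def adj_def)
  ultimately show ?thesis using that by blast
qed

text \<open>With the common edge length in place of the facet's own, the diagonal at
  \<open>v\<close> has the same length in every facet through \<open>v\<close>.\<close>

lemma facet_neighbours:
  assumes F: "F \<in> facets" and v: "v \<in> S" "v \<in> F" and l: "\<And>v w. adj v w \<Longrightarrow> dist v w = l"
  obtains w1 w2 where "w1 \<noteq> w2" "{w \<in> F. adj v w} = {w1, w2}"
    "(dist w1 w2)\<^sup>2 = 2 * l\<^sup>2 * (1 + cos (2 * pi / p))"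
proof -
  obtain n l' where "norm n = 1" "l' > 0"
    and fs: "\<And>v w. \<lbrakk>adj v w; v \<in> F; w \<in> F\<rbrakk> \<Longrightarrow> dist v w = l'"
    and "\<And>v. v \<in> S \<inter> F \<Longrightarrow> S \<inter> F = (\<lambda>k. rot n (real k * (2 * pi / p)) v) ` {..<p}"
    and fs': "\<And>v. v \<in> S \<inter> F \<Longrightarrow> {w \<in> F. adj v w} = {rot n (2 * pi / p) v, rot n (- (2 * pi / p)) v}"
    "\<And>v. v \<in> S \<inter> F \<Longrightarrow> rot n (2 * pi / p) v \<noteq> rot n (- (2 * pi / p)) v"
    "\<And>v. v \<in> S \<inter> F \<Longrightarrow>
       (dist (rot n (2 * pi / p) v) (rot n (- (2 * pi / p)) v))\<^sup>2 = 2 * l'\<^sup>2 * (1 + cos (2 * pi / p))"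
    by (rule facet_structure[OF F]) (rule that; assumption)
  have vF: "v \<in> S \<inter> F" using v by blast
  obtain w where "adj v w" "w \<in> F" using facet_two_neighbours[OF F v] by blast
  then have "l' = l" using fs[of v w] l[of v w] v by simp
  then show ?thesis using that[OF fs'(2,1)[OF vF]] fs'(3)[OF vF] by simp
qed

section \<open>The neighbours of a vertex and rigid motions\<close>

text \<open>The neighbours of \<open>v\<close> lie on a circle about the axis \<open>v\<close>
  because all edges are equally long. Those in a common facet span a chord that the facet normal
  supports, so \<open>circle_orbit\<close> applies. Facets at \<open>v\<close> correspond to pairs
  of consecutive neighbours, which makes the number of neighbours \<open>q\<close>.\<close>

lemma vertex_structure:
  assumes v: "v \<in> S" and w: "adj v w"
  shows "{w. adj v w} = (\<lambda>k. rot v (real k * (2 * pi / q)) w) ` {..<q}"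
proof -
  obtain l where l: "l > 0" "\<And>v w. adj v w \<Longrightarrow> dist v w = l" using edge_length by blast
  define N where "N = {w. adj v w}"
  have nv: "norm v = 1" using norm_vertex v by simp
  have NS: "N \<subseteq> S" using adj_vertices by (auto simp: N_def)
  have circ: "norm x = 1" "v \<bullet> x = 1 - l\<^sup>2 / 2" if "x \<in> N" for x
  proof -
    show nx: "norm x = 1" using that NS norm_vertex by auto
    have "l\<^sup>2 = (norm (v - x))\<^sup>2" using that l(2)[of v x] by (simp add: N_def dist_norm)
    also have "\<dots> = 2 - 2 * (v \<bullet> x)"
      using nv nx by (simp add: power2_norm_eq_inner inner_diff_left inner_diff_right inner_commute norm_eq_1)
    finally show "v \<bullet> x = 1 - l\<^sup>2 / 2" by (simp add: field_simps)
  qed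
  \<comment> \<open>The common length of the facet diagonals that join two neighbours of
    \<open>v\<close>.\<close>
  define D where "D = sqrt (2 * l\<^sup>2 * (1 + cos (2 * pi / p)))"
  have D: "dist x y = D" if "(dist x y)\<^sup>2 = 2 * l\<^sup>2 * (1 + cos (2 * pi / p))" for x y :: "real^3"
    unfolding D_def that[symmetric] by simp
  obtain F0 where F0: "F0 \<in> facets" "v \<in> F0" using facet_at_vertex[OF v] by blast
  obtain x0 y0 where "x0 \<noteq> y0" "{w \<in> F0. adj v w} = {x0, y0}" "(dist x0 y0)\<^sup>2 = 2 * l\<^sup>2 * (1 + cos (2 * pi / p))"
    by (rule facet_neighbours[OF F0(1) v F0(2) l(2)])
  then have "D > 0" using D by (metis zero_less_dist_iff)
  define supp where "supp x y \<longleftrightarrow> (\<exists>a. v \<times> a \<noteq> 0 \<and> a \<bullet> y = a \<bullet> x \<and> (\<forall>z\<in>N. a \<bullet> z \<le> a \<bullet> x))" for x y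
  have third: "\<exists>y. y \<noteq> x \<and> {z \<in> F. adj v z} = {x, y} \<and> dist x y = D \<and> supp x y"
    if F: "F \<in> facets" "v \<in> F" and x: "x \<in> F" "adj v x" for F x
  proof -
    obtain w1 w2 where w12: "w1 \<noteq> w2" "{w \<in> F. adj v w} = {w1, w2}"
      "(dist w1 w2)\<^sup>2 = 2 * l\<^sup>2 * (1 + cos (2 * pi / p))"
      by (rule facet_neighbours[OF F(1) v F(2) l(2)])
    have w12D: "dist w1 w2 = D" using D w12(3) .
    have "x = w1 \<or> x = w2" using w12(2) x by blast
    then obtain y where y: "y \<noteq> x" "{w \<in> F. adj v w} = {x, y}" "dist x y = D"
    proof
      assume "x = w1"
      then show ?thesis using that[of w2] w12 w12D by auto
    next
      assume "x = w2"
      then show ?thesis using that[of w1] w12 w12D by (auto simp: dist_commute)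
    qed
    obtain a c where a: "norm a = 1" "\<And>x. x \<in> P \<Longrightarrow> a \<bullet> x \<le> c" "F = P \<inter> {x. a \<bullet> x = c}"
      using facet_normal[OF F(1)] by blast
    have "y \<in> F" using y(2) by blast
    then have eq: "a \<bullet> v = c" "a \<bullet> x = c" "a \<bullet> y = c" using a F x by auto
    \<comment> \<open>A facet normal parallel to \<open>v\<close> would force
      \<open>v \<bullet> x = 1\<close>, although \<open>x\<close> has positive distance from
      \<open>v\<close>.\<close>
    have "v \<times> a \<noteq> 0"
    proof
      assume "v \<times> a = 0"
      then have av: "a = (v \<bullet> a) *\<^sub>R v" using cross_cross_unit[OF nv, of a] by simp
      then have "v \<bullet> a \<noteq> 0" using a(1) by auto
      have "(v \<bullet> a) * (v \<bullet> x) = a \<bullet> x" by (subst (2) av) simp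
      moreover have "a \<bullet> x = v \<bullet> a" using eq by (simp add: inner_commute)
      ultimately have "v \<bullet> x = 1" using \<open>v \<bullet> a \<noteq> 0\<close> by simp
      then show False using circ(2)[of x] x l(1) by (simp add: N_def)
    qed
    moreover have "\<forall>z\<in>N. a \<bullet> z \<le> a \<bullet> x" using a(2) NS eq hull_subset[of S convex] by auto
    ultimately have "supp x y" unfolding supp_def using eq by (intro exI[of _ a]) simp
    then show ?thesis using y by blast
  qed
  \<comment> \<open>The edge from \<open>v\<close> to \<open>x\<close> lies in two facets, each of
    which contributes one further neighbour. These differ, since two facets with three common
    vertices are equal.\<close>
  have nb: "\<exists>w1\<in>N. \<exists>w2\<in>N. w1 \<noteq> w2 \<and> (\<forall>y\<in>{w1,w2}. dist x y = D \<and> supp x y) \<and>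
               (\<exists>F\<in>facets. v \<in> F \<and> x \<in> F \<and> w1 \<in> F) \<and> (\<exists>F\<in>facets. v \<in> F \<and> x \<in> F \<and> w2 \<in> F)" if x: "x \<in> N" for x
  proof -
    have vx: "adj v x" using x by (simp add: N_def)
    obtain F1 F2 where F: "F1 \<in> facets" "F2 \<in> facets" "F1 \<noteq> F2" "v \<in> F1" "x \<in> F1" "v \<in> F2" "x \<in> F2"
      by (rule edge_two_facets[OF vx])
    obtain y1 where y1: "y1 \<noteq> x" "{z \<in> F1. adj v z} = {x, y1}" "dist x y1 = D" "supp x y1"
      using third[OF F(1,4,5) vx] by blast
    obtain y2 where y2: "y2 \<noteq> x" "{z \<in> F2. adj v z} = {x, y2}" "dist x y2 = D" "supp x y2"
      using third[OF F(2,6,7) vx] by blast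
    have y: "adj v y1" "y1 \<in> F1" "adj v y2" "y2 \<in> F2" using y1(2) y2(2) by blast+
    have "y1 \<noteq> y2"
    proof
      assume "y1 = y2"
      then have "F1 = F2"
        using y F y1(1) vx adj_vertices by (intro facet_eqI[of F1 F2 v x y1]) (auto simp: adj_def)
      then show False using F by simp
    qed
    moreover have "y1 \<in> N" "y2 \<in> N" using y by (auto simp: N_def)
    moreover have "\<forall>y\<in>{y1, y2}. dist x y = D \<and> supp x y" using y1(3,4) y2(3,4) by simp
    moreover have "\<exists>F\<in>facets. v \<in> F \<and> x \<in> F \<and> y1 \<in> F" "\<exists>F\<in>facets. v \<in> F \<and> x \<in> F \<and> y2 \<in> F"
      using F y by blast+
    ultimately show ?thesis by (intro bexI[of _ y1] bexI[of _ y2] conjI)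
  qed
  have "N \<noteq> {}" using w by (auto simp: N_def)
  have nb': "\<exists>w1\<in>N. \<exists>w2\<in>N. w1 \<noteq> w2 \<and> (\<forall>y\<in>{w1,w2}. dist x y = D \<and>
               (\<exists>a. v \<times> a \<noteq> 0 \<and> a \<bullet> y = a \<bullet> x \<and> (\<forall>z\<in>N. a \<bullet> z \<le> a \<bullet> x)))" if "x \<in> N" for x
    using nb[OF that] unfolding supp_def by meson
  obtain \<alpha> where \<alpha>: "\<alpha> = 2 * pi / real (card N)"
    and orbit: "\<And>x. x \<in> N \<Longrightarrow> N = (\<lambda>k. rot v (real k * \<alpha>) x) ` {..<card N}"
    and part: "\<And>x y. \<lbrakk>x \<in> N; y \<in> N; dist x y = D\<rbrakk> \<Longrightarrow> y = rot v \<alpha> x \<or> y = rot v (-\<alpha>) x"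
    and neq: "\<And>x. x \<in> N \<Longrightarrow> rot v \<alpha> x \<noteq> rot v (-\<alpha>) x"
    by (rule circle_orbit[OF nv \<open>N \<noteq> {}\<close> circ \<open>D > 0\<close> nb']) blast+
  \<comment> \<open>The facet through \<open>v\<close>, \<open>x\<close> and the neighbour that
    follows \<open>x\<close> in the rotation. It is unique by \<open>facet_eqI\<close>, and its
    bijectivity as a map counts the neighbours.\<close>
  define \<phi> where "\<phi> x = (THE F. F \<in> facets \<and> v \<in> F \<and> x \<in> F \<and> rot v \<alpha> x \<in> F)" for x
  have nxt: "rot v \<alpha> x \<in> N \<and> rot v \<alpha> x \<noteq> x \<and> (\<exists>F\<in>facets. v \<in> F \<and> x \<in> F \<and> rot v \<alpha> x \<in> F)" if x: "x \<in> N" for x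
  proof -
    obtain w1 w2 where w: "w1 \<in> N" "w2 \<in> N" "w1 \<noteq> w2" "dist x w1 = D" "dist x w2 = D"
      "\<exists>F\<in>facets. v \<in> F \<and> x \<in> F \<and> w1 \<in> F" "\<exists>F\<in>facets. v \<in> F \<and> x \<in> F \<and> w2 \<in> F"
      using nb[OF x] by (metis insert_iff)
    then have "rot v \<alpha> x = w1 \<or> rot v \<alpha> x = w2" using part[OF x] by metis
    then show ?thesis using w \<open>D > 0\<close> by auto
  qed
  have \<phi>: "\<phi> x \<in> facets \<and> v \<in> \<phi> x \<and> x \<in> \<phi> x \<and> rot v \<alpha> x \<in> \<phi> x" and
    \<phi>_eq: "\<And>F. F \<in> facets \<Longrightarrow> v \<in> F \<Longrightarrow> x \<in> F \<Longrightarrow> rot v \<alpha> x \<in> F \<Longrightarrow> \<phi> x = F" if x: "x \<in> N" for x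
  proof -
    have uniq: "F = F'" if "F \<in> facets \<and> v \<in> F \<and> x \<in> F \<and> rot v \<alpha> x \<in> F"
      "F' \<in> facets \<and> v \<in> F' \<and> x \<in> F' \<and> rot v \<alpha> x \<in> F'" for F F'
      using that nxt[OF x] x v NS
      by (intro facet_eqI[of F F' v x "rot v \<alpha> x"]) (auto simp: N_def adj_def)
    have "\<exists>!F. F \<in> facets \<and> v \<in> F \<and> x \<in> F \<and> rot v \<alpha> x \<in> F" using nxt[OF x] uniq by blast
    from theI'[OF this] show "\<phi> x \<in> facets \<and> v \<in> \<phi> x \<and> x \<in> \<phi> x \<and> rot v \<alpha> x \<in> \<phi> x"
      unfolding \<phi>_def .
    then show "\<phi> x = F" if "F \<in> facets" "v \<in> F" "x \<in> F" "rot v \<alpha> x \<in> F" for F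
      using uniq that by blast
  qed
  have "bij_betw \<phi> N {F \<in> facets. v \<in> F}"
    unfolding bij_betw_def
  proof
    \<comment> \<open>A facet contains only two neighbours of \<open>v\<close>. Two different
      neighbours with the same facet would therefore follow each other, so the rotations by \<alpha>
      and by its negative would agree on \<open>x\<close>, against \<open>neq\<close>.\<close>
    show "inj_on \<phi> N"
    proof (rule inj_onI, rule ccontr)
      fix x y assume xy: "x \<in> N" "y \<in> N" "\<phi> x = \<phi> y" "x \<noteq> y"
      have "adj v x" "adj v (rot v \<alpha> x)" "adj v y" "adj v (rot v \<alpha> y)"
        using nxt xy by (auto simp: N_def)
      moreover obtain w1 w2 where "{w \<in> \<phi> x. adj v w} = {w1, w2}"
        using third[of "\<phi> x" x] \<phi>[OF xy(1)] xy(1) unfolding N_def by blast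
      ultimately have "{x, rot v \<alpha> x, y, rot v \<alpha> y} \<subseteq> {w1, w2}"
        using \<phi>[OF xy(1)] \<phi>[OF xy(2)] xy(3) by auto
      then have "y = rot v \<alpha> x" "x = rot v \<alpha> y"
        using xy nxt[OF xy(1)] nxt[OF xy(2)] by auto
      then have "rot v (-\<alpha>) x = rot v (-\<alpha>) (rot v \<alpha> (rot v \<alpha> x))" by metis
      then have "rot v (-\<alpha>) x = rot v \<alpha> x" by (simp add: rot_add nv)
      then show False using neq[OF xy(1)] by simp
    qed
    show "\<phi> ` N = {F \<in> facets. v \<in> F}"
    proof
      show "\<phi> ` N \<subseteq> {F \<in> facets. v \<in> F}" using \<phi> by blast
      show "{F \<in> facets. v \<in> F} \<subseteq> \<phi> ` N"
      proof
        fix F assume "F \<in> {F \<in> facets. v \<in> F}"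
        then have F: "F \<in> facets" "v \<in> F" by auto
        obtain x where x: "adj v x" "x \<in> F" using facet_two_neighbours[OF F(1) v F(2)] by blast
        then obtain y where y: "adj v y" "y \<in> F" "dist x y = D"
          using third[OF F x(2,1)] by (metis (mono_tags, lifting) insertI1 insertI2 mem_Collect_eq)
        have N: "x \<in> N" "y \<in> N" using x y by (auto simp: N_def)
        \<comment> \<open>The two neighbours in \<open>F\<close> are one step apart in one direction
          or the other, and the earlier one is the preimage of \<open>F\<close>.\<close>
        from part[OF this y(3)] show "F \<in> \<phi> ` N"
        proof
          assume "y = rot v \<alpha> x"
          then have "\<phi> x = F" using \<phi>_eq[OF N(1) F] x y by simp
          then show ?thesis using N by blast
        next
          assume "y = rot v (-\<alpha>) x"
          then have "x = rot v \<alpha> y" by (simp add: rot_add nv)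
          then have "\<phi> y = F" using \<phi>_eq[OF N(2) F] x y by simp
          then show ?thesis using N by blast
        qed
      qed
    qed
  qed
  then have "card N = q" using card_facets_at[OF v] bij_betw_same_card by metis
  then show ?thesis using orbit[of w] w \<alpha> by (simp add: N_def)
qed

text \<open>Rotations commute with rotating about a transported axis, so
  \<open>vertex_structure\<close> determines the images of all edges at a vertex from the image of
  one. This spreads around each facet and then from facet to facet.\<close>

lemma rigid_motion_edges:
  assumes R: "R \<in> SO3" and e0: "adj v0 w0" "adj (R *v v0) (R *v w0)" and "adj v w"
  shows "adj (R *v v) (R *v w)"
proof -
  define good where "good v \<longleftrightarrow> v \<in> S \<and> (\<forall>w. adj v w \<longrightarrow> adj (R *v v) (R *v w))" for v
  \<comment> \<open>\<open>R\<close> carries the orbit of \<open>w\<close> about \<open>v\<close> to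
    the orbit of the image of \<open>w\<close> about the image of \<open>v\<close>. By
    \<open>vertex_structure\<close> at both places these orbits are the full neighbour sets.\<close>
  have vertex: "good v" if vw: "adj v w" "adj (R *v v) (R *v w)" for v w
  proof -
    have v: "v \<in> S" "R *v v \<in> S" using vw adj_vertices by auto
    have "adj (R *v v) (R *v x)" if "adj v x" for x
    proof -
      have "x \<in> (\<lambda>k. rot v (real k * (2 * pi / q)) w) ` {..<q}"
        using vertex_structure[OF v(1) vw(1)] that by blast
      then obtain k where k: "k < q" "x = rot v (real k * (2 * pi / q)) w" by blast
      have "R *v x = rot (R *v v) (real k * (2 * pi / q)) (R *v w)"
        by (simp only: k SO3_rot[OF R])
      then have "R *v x \<in> {w. adj (R *v v) w}"
        unfolding vertex_structure[OF v(2) vw(2)] using k by blast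
      then show ?thesis by simp
    qed
    then show ?thesis using v by (simp add: good_def)
  qed
  \<comment> \<open>Read backwards, the edge is one at \<open>w\<close> whose image is an
    edge.\<close>
  have edge: "good w" if "good v" "adj v w" for v w
    using that vertex[of w v] adj_sym by (auto simp: good_def)
  define \<A> where "\<A> = {F \<in> facets. \<forall>v\<in>S \<inter> F. good v}"
  have facet: "F \<in> \<A>" if F: "F \<in> facets" and v: "good v" "v \<in> F" for F v
  proof -
    have vF: "v \<in> S \<inter> F" using v by (simp add: good_def)
    obtain n l where n: "norm n = 1" and "l > 0"
      and "\<And>v w. \<lbrakk>adj v w; v \<in> F; w \<in> F\<rbrakk> \<Longrightarrow> dist v w = l"
      and orb: "\<And>v. v \<in> S \<inter> F \<Longrightarrow> S \<inter> F = (\<lambda>k. rot n (real k * (2 * pi / p)) v) ` {..<p}"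
      and nbs: "\<And>v. v \<in> S \<inter> F \<Longrightarrow> {w \<in> F. adj v w} = {rot n (2 * pi / p) v, rot n (- (2 * pi / p)) v}"
      and "\<And>v. v \<in> S \<inter> F \<Longrightarrow> rot n (2 * pi / p) v \<noteq> rot n (- (2 * pi / p)) v"
      and "\<And>v. v \<in> S \<inter> F \<Longrightarrow>
       (dist (rot n (2 * pi / p) v) (rot n (- (2 * pi / p)) v))\<^sup>2 = 2 * l\<^sup>2 * (1 + cos (2 * pi / p))"
      by (rule facet_structure[OF F]) (rule that; assumption)
    \<comment> \<open>Walking around the facet from \<open>v\<close>, each step goes from a good
      vertex to an adjacent one.\<close>
    have "good (rot n (real k * (2 * pi / p)) v) \<and> rot n (real k * (2 * pi / p)) v \<in> F" for k
    proof (induction k)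
      case 0
      then show ?case using v by simp
    next
      case (Suc k)
      define u where "u = rot n (real k * (2 * pi / p)) v"
      have u: "good u" "u \<in> S \<inter> F" using Suc by (auto simp: u_def good_def)
      have "rot n (2 * pi / p) u \<in> {w \<in> F. adj u w}" using nbs[OF u(2)] by blast
      then have "good (rot n (2 * pi / p) u) \<and> rot n (2 * pi / p) u \<in> F" using edge u by blast
      moreover have "rot n (2 * pi / p) u = rot n (real (Suc k) * (2 * pi / p)) v"
        by (simp add: u_def rot_add n algebra_simps add_divide_distrib)
      ultimately show ?case by simp
    qed
    then show ?thesis using F orb[OF vF] by (auto simp: \<A>_def)
  qed
  have "good v0" using vertex e0 by blast
  then obtain F0 where "F0 \<in> facets" "v0 \<in> F0" using facet_at_vertex by (auto simp: good_def)
  then have "F0 \<in> \<A>" using facet \<open>good v0\<close> by blast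
  have "\<A> = facets"
  proof (rule facet_induct)
    show "\<A> \<subseteq> facets" by (auto simp: \<A>_def)
    show "\<A> \<noteq> {}" using \<open>F0 \<in> \<A>\<close> by blast
    show "F' \<in> \<A>" if "F \<in> \<A>" "F' \<in> facets" "adj v w" "v \<in> F" "w \<in> F" "v \<in> F'" "w \<in> F'" for F F' v w
    proof (rule facet[OF that(2) _ that(6)])
      show "good v" using that(1,3,4) adj_vertices by (simp add: \<A>_def)
    qed
  qed
  then show ?thesis
    using facet_at_vertex[of v] adj_vertices[OF \<open>adj v w\<close>] \<open>adj v w\<close>
    by (auto simp: \<A>_def good_def)
qed

text \<open>The rotation fixes \<open>v\<close> and moves each neighbour to the next, so it maps an
  edge to an edge and \<open>rigid_motion_edges\<close> applies. Every vertex lies on an edge, hence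
  goes to a vertex; injectivity on the finite set \<open>S\<close> gives the rest.\<close>

lemma rot_vertices:
  assumes v: "v \<in> S"
  shows "bij_betw (rot v (2 * pi / q)) S S"
proof -
  have nv: "norm v = 1" using v norm_vertex by simp
  obtain R where R: "R \<in> SO3" "\<And>x. R *v x = rot v (2 * pi / q) x"
    using rot_SO3[OF nv] by blast
  obtain w where w: "adj v w" using neighbour_exists[OF v] by blast
  have "rot v (real 1 * (2 * pi / q)) w \<in> {w. adj v w}"
    unfolding vertex_structure[OF v w] using q by (intro imageI) simp
  then have e: "adj (R *v v) (R *v w)" by (simp add: R rot_axis nv)
  have "rot v (2 * pi / q) u \<in> S" if u: "u \<in> S" for u
  proof -
    obtain x where "adj u x" using neighbour_exists[OF u] by blast
    then show ?thesis
      using rigid_motion_edges[OF R(1) w e] adj_vertices by (metis R(2))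
  qed
  moreover have "inj_on (rot v (2 * pi / q)) S"
    by (rule inj_on_inverseI[of _ "rot v (- (2 * pi / q))"]) (simp add: rot_add nv)
  ultimately show ?thesis
    using endo_inj_surj[OF finite_S, of "rot v (2 * pi / q)"] by (auto simp: bij_betw_def)
qed

end

subsection \<open>The closed-loop system\<close>

text \<open>Multiplication by a suitable exponential makes \<open>g\<close> decreasing to the right
  of 0 and increasing to the left. Both directions occur because \<open>I\<close> may extend to
  either side of 0.\<close>

lemma gronwall_zero:
  fixes g g' :: "real \<Rightarrow> real"
  assumes I: "is_interval I" "0 \<in> I" and t: "t \<in> I"
    and der: "\<And>s. s \<in> I \<Longrightarrow> (g has_real_derivative g' s) (at s within I)"
    and bound: "\<And>s. s \<in> I \<Longrightarrow> \<bar>g' s\<bar> \<le> K * g s"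
    and nonneg: "\<And>s. s \<in> I \<Longrightarrow> 0 \<le> g s" and zero: "g 0 = 0"
  shows "g t = 0"
proof -
  have sub: "s \<in> I" if "a \<in> I" "b \<in> I" "a \<le> s" "s \<le> b" for a b s
    using I(1) that by (meson is_interval_1)
  have der_exp: "((\<lambda>s. exp (c * s) * g s) has_real_derivative exp (c * s) * (c * g s + g' s)) (at s within A)"
    if "s \<in> I" "A \<subseteq> I" for c s A
    using DERIV_subset[OF der[OF that(1)] that(2)]
    by (auto intro!: derivative_eq_intros simp: algebra_simps)
  have cont: "continuous_on {a..b} (\<lambda>s. exp (c * s) * g s)" if "a \<in> I" "b \<in> I" for a b c
    by (rule DERIV_continuous_on, rule der_exp) (use sub[OF that] in auto)
  \<comment> \<open>At interior points the derivative within \<open>I\<close> is two-sided. The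
    monotonicity rules ask for that on an open interval only, with continuity up to the
    ends.\<close>
  have der_at: "((\<lambda>s. exp (c * s) * g s) has_real_derivative exp (c * s) * (c * g s + g' s)) (at s)"
    if "a \<in> I" "b \<in> I" "a < s" "s < b" for a b c s
  proof -
    have "{a<..<b} \<subseteq> I" using sub[OF that(1,2)] by (auto intro: less_imp_le)
    then show ?thesis
      using der_exp[of s "{a<..<b}" c] that at_within_open[of s "{a<..<b}"] by auto
  qed
  have "g t \<le> 0"
  proof (cases "t \<ge> 0")
    case True
    have "exp (- K * t) * g t \<le> exp (- K * 0) * g 0"
    proof (rule DERIV_nonpos_imp_decreasing_open[OF True _ cont[OF I(2) t]])
      fix s assume s: "0 < s" "s < t"
      have "- K * g s + g' s \<le> 0" using bound[OF sub[OF I(2) t, of s]] s by auto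
      then have "exp (- K * s) * (- K * g s + g' s) \<le> 0" by (simp add: mult_nonneg_nonpos)
      then show "\<exists>y. ((\<lambda>s. exp (- K * s) * g s) has_real_derivative y) (at s) \<and> y \<le> 0"
        using der_at[OF I(2) t s] by blast
    qed
    then show ?thesis by (simp add: zero mult_le_0_iff)
  next
    case False
    then have "t \<le> 0" by simp
    have "exp (K * t) * g t \<le> exp (K * 0) * g 0"
    proof (rule DERIV_nonneg_imp_increasing_open[OF \<open>t \<le> 0\<close> _ cont[OF t I(2)]])
      fix s assume s: "t < s" "s < 0"
      have "K * g s + g' s \<ge> 0" using bound[OF sub[OF t I(2), of s]] s by auto
      then have "exp (K * s) * (K * g s + g' s) \<ge> 0" by simp
      then show "\<exists>y. ((\<lambda>s. exp (K * s) * g s) has_real_derivative y) (at s) \<and> y \<ge> 0"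
        using der_at[OF t I(2) s] by blast
    qed
    then show ?thesis by (simp add: zero mult_le_0_iff)
  qed
  then show ?thesis using nonneg[OF t] by simp
qed

lemma cross_sum_right: "a \<times> (\<Sum>j\<in>A. f j) = (\<Sum>j\<in>A. a \<times> f j)"
  by (induction A rule: infinite_finite_induct) (simp_all add: cross_add_right)

lemma closed_loop_rhs_sum:
  "closed_loop_rhs h E G i =
     (\<Sum>j\<in>{j. (i, j) \<in> E}. h (arccos (G i \<bullet> G j)) *\<^sub>R (G i \<times> (G i \<times> G j)))"
  by (simp add: closed_loop_rhs_def cross_sum_right cross_mult_right)

text \<open>For unit vectors the double cross product is
  \<open>(a \<bullet> b) *\<^sub>R a - b\<close>. The term is thus a product of two bounded
  Lipschitz factors; the value of \<open>h\<close> at \<open>arccos 0\<close> enters as the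
  reference value that bounds the first.\<close>

lemma pairwise_term_lipschitz:
  fixes a b a' b' :: "real^3"
  assumes lip: "L-lipschitz_on {-1..1} (h \<circ> arccos)"
    and n: "norm a = 1" "norm b = 1" "norm a' = 1" "norm b' = 1"
  shows "norm (h (arccos (a \<bullet> b)) *\<^sub>R (a \<times> (a \<times> b)) - h (arccos (a' \<bullet> b')) *\<^sub>R (a' \<times> (a' \<times> b')))
      \<le> 2 * (2 * L + \<bar>h (arccos 0)\<bar>) * (norm (a - a') + norm (b - b'))"
proof -
  define H where "H u = h (arccos u)" for u
  define \<delta> where "\<delta> = norm (a - a') + norm (b - b')"
  have L: "L \<ge> 0" using lip by (rule lipschitz_on_nonneg)
  have H: "\<bar>H u - H w\<bar> \<le> L * \<bar>u - w\<bar>" if "\<bar>u\<bar> \<le> 1" "\<bar>w\<bar> \<le> 1" for u w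
    using lipschitz_onD[OF lip, of u w] that by (auto simp: H_def dist_real_def abs_le_iff)
  have ab: "\<bar>a \<bullet> b\<bar> \<le> 1" and ab': "\<bar>a' \<bullet> b'\<bar> \<le> 1"
    using Cauchy_Schwarz_ineq2[of a b] Cauchy_Schwarz_ineq2[of a' b'] n by auto
  have dab: "\<bar>a \<bullet> b - a' \<bullet> b'\<bar> \<le> \<delta>"
  proof -
    have "a \<bullet> b - a' \<bullet> b' = (a - a') \<bullet> b + a' \<bullet> (b - b')"
      by (simp add: inner_diff_left inner_diff_right)
    also have "\<bar>\<dots>\<bar> \<le> \<bar>(a - a') \<bullet> b\<bar> + \<bar>a' \<bullet> (b - b')\<bar>" by (rule abs_triangle_ineq)
    also have "\<dots> \<le> \<delta>"
      using Cauchy_Schwarz_ineq2[of "a - a'" b] Cauchy_Schwarz_ineq2[of a' "b - b'"] n by (simp add: \<delta>_def)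
    finally show ?thesis .
  qed
  define X where "X = (a \<bullet> b) *\<^sub>R a - b"
  define X' where "X' = (a' \<bullet> b') *\<^sub>R a' - b'"
  have X2: "norm X \<le> 2"
    using norm_triangle_ineq4[of "(a \<bullet> b) *\<^sub>R a" b] ab n by (simp add: X_def)
  have dX: "norm (X - X') \<le> 2 * \<delta>"
  proof -
    have "X - X' = (a \<bullet> b - a' \<bullet> b') *\<^sub>R a + ((a' \<bullet> b') *\<^sub>R (a - a') + (b' - b))"
      by (simp add: X_def X'_def algebra_simps)
    also have "norm \<dots> \<le> norm ((a \<bullet> b - a' \<bullet> b') *\<^sub>R a) + norm ((a' \<bullet> b') *\<^sub>R (a - a') + (b' - b))"
      by (rule norm_triangle_ineq)
    also have "\<dots> \<le> norm ((a \<bullet> b - a' \<bullet> b') *\<^sub>R a) + (norm ((a' \<bullet> b') *\<^sub>R (a - a')) + norm (b' - b))"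
      by (intro add_left_mono norm_triangle_ineq)
    also have "\<dots> \<le> \<delta> + (norm (a - a') + norm (b - b'))"
      using dab ab' n mult_right_mono[OF ab', of "norm (a - a')"] by (simp add: norm_minus_commute)
    finally show ?thesis by (simp add: \<delta>_def)
  qed
  have HB: "\<bar>H (a' \<bullet> b')\<bar> \<le> \<bar>H 0\<bar> + L"
  proof -
    have "\<bar>H (a' \<bullet> b') - H 0\<bar> \<le> L * \<bar>a' \<bullet> b'\<bar>" using H[OF ab', of 0] by simp
    also have "\<dots> \<le> L * 1" using ab' L by (rule mult_left_mono)
    finally show ?thesis by linarith
  qed
  have "H (a \<bullet> b) *\<^sub>R X - H (a' \<bullet> b') *\<^sub>R X' = (H (a \<bullet> b) - H (a' \<bullet> b')) *\<^sub>R X + H (a' \<bullet> b') *\<^sub>R (X - X')"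
    by (simp add: algebra_simps)
  also have "norm \<dots> \<le> \<bar>H (a \<bullet> b) - H (a' \<bullet> b')\<bar> * norm X + \<bar>H (a' \<bullet> b')\<bar> * norm (X - X')"
    by (rule norm_triangle_le) simp
  also have "\<dots> \<le> (L * \<delta>) * 2 + (\<bar>H 0\<bar> + L) * (2 * \<delta>)"
  proof (intro add_mono mult_mono)
    show "\<bar>H (a \<bullet> b) - H (a' \<bullet> b')\<bar> \<le> L * \<delta>"
      using H[OF ab ab'] mult_left_mono[OF dab L] by linarith
  qed (use X2 dX HB L in \<open>auto simp: \<delta>_def\<close>)
  also have "\<dots> = 2 * (2 * L + \<bar>H 0\<bar>) * \<delta>" by (simp add: algebra_simps)
  finally show ?thesis
    using n by (simp add: X_def X'_def H_def \<delta>_def cross_cross_unit)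
qed

text \<open>The solution is compared with the constant one. The summed squared distance
  \<open>g\<close> between them satisfies a linear differential inequality by the pairwise Lipschitz
  bound, so \<open>gronwall_zero\<close> makes it vanish.\<close>

lemma closed_loop_equilibrium_unique:
  fixes x :: "real \<Rightarrow> nat \<Rightarrow> real^3"
  assumes V: "finite V" "Field E \<subseteq> V" and lip: "L-lipschitz_on {-1..1} (h \<circ> arccos)"
    and I: "is_interval I" "0 \<in> I"
    and unit: "\<And>t i. \<lbrakk>t \<in> I; i \<in> V\<rbrakk> \<Longrightarrow> norm (x t i) = 1"
    and ode: "\<And>t i. \<lbrakk>t \<in> I; i \<in> V\<rbrakk> \<Longrightarrow>
        ((\<lambda>s. x s i) has_vector_derivative closed_loop_rhs h E (x t) i) (at t within I)"
    and eq: "\<And>i. i \<in> V \<Longrightarrow> closed_loop_rhs h E (x 0) i = 0"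
    and t: "t \<in> I" and i: "i \<in> V"
  shows "x t i = x 0 i"
proof -
  define f where "f s i = closed_loop_rhs h E (x s) i" for s i
  define d where "d s i = norm (x s i - x 0 i)" for s i
  define C where "C = 2 * (2 * L + \<bar>h (arccos 0)\<bar>)"
  have "C \<ge> 0" using lipschitz_on_nonneg[OF lip] by (simp add: C_def)
  define g where "g s = (\<Sum>i\<in>V. (d s i)\<^sup>2)" for s
  define g' where "g' s = (\<Sum>i\<in>V. 2 * ((x s i - x 0 i) \<bullet> f s i))" for s
  have f: "norm (f s i) \<le> (\<Sum>j\<in>V. C * (d s i + d s j))" if s: "s \<in> I" and i: "i \<in> V" for s i
  proof -
    define N where "N = {j. (i, j) \<in> E}"
    have N: "N \<subseteq> V" using V by (auto simp: N_def intro: FieldI2)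
    have "f s i = f s i - closed_loop_rhs h E (x 0) i" using eq[OF i] by simp
    also have "\<dots> = (\<Sum>j\<in>N. h (arccos (x s i \<bullet> x s j)) *\<^sub>R (x s i \<times> (x s i \<times> x s j))
        - h (arccos (x 0 i \<bullet> x 0 j)) *\<^sub>R (x 0 i \<times> (x 0 i \<times> x 0 j)))"
      by (simp add: f_def closed_loop_rhs_sum N_def sum_subtractf)
    also have "norm \<dots> \<le> (\<Sum>j\<in>N. C * (d s i + d s j))"
      unfolding C_def d_def
      by (rule sum_norm_le, rule pairwise_term_lipschitz[OF lip]) (use unit s i N I in auto)
    also have "\<dots> \<le> (\<Sum>j\<in>V. C * (d s i + d s j))"
      using N V \<open>C \<ge> 0\<close> by (intro sum_mono2) (auto simp: d_def)
    finally show ?thesis .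
  qed
  \<comment> \<open>The factor 6 comes from \<open>2 * C\<close> times the weights 2 and 1 of the
    two squares; each square, summed over both indices, gives \<open>card V\<close> times
    \<open>g\<close>.\<close>
  have bound: "\<bar>g' s\<bar> \<le> (6 * C * card V) * g s" if s: "s \<in> I" for s
  proof -
    have "\<bar>g' s\<bar> \<le> (\<Sum>i\<in>V. \<bar>2 * ((x s i - x 0 i) \<bullet> f s i)\<bar>)"
      unfolding g'_def by (rule sum_abs)
    also have "\<dots> \<le> (\<Sum>i\<in>V. \<Sum>j\<in>V. 2 * C * (2 * (d s i)\<^sup>2 + (d s j)\<^sup>2))"
    proof (rule sum_mono)
      fix i assume i: "i \<in> V"
      have "\<bar>2 * ((x s i - x 0 i) \<bullet> f s i)\<bar> \<le> 2 * (d s i * norm (f s i))"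
        using Cauchy_Schwarz_ineq2[of "x s i - x 0 i" "f s i"] by (simp add: d_def abs_mult)
      also have "\<dots> \<le> 2 * (d s i * (\<Sum>j\<in>V. C * (d s i + d s j)))"
        using f[OF s i] by (intro mult_left_mono) (auto simp: d_def)
      also have "\<dots> = (\<Sum>j\<in>V. 2 * C * (d s i * (d s i + d s j)))"
        by (simp add: sum_distrib_left algebra_simps)
      also have "\<dots> \<le> (\<Sum>j\<in>V. 2 * C * (2 * (d s i)\<^sup>2 + (d s j)\<^sup>2))"
      proof (rule sum_mono)
        fix j
        have "0 \<le> d s i * d s j" by (simp add: d_def)
        then have "d s i * (d s i + d s j) \<le> 2 * (d s i)\<^sup>2 + (d s j)\<^sup>2"
          using sum_squares_bound[of "d s i" "d s j"] zero_le_power2[of "d s i"] zero_le_power2[of "d s j"]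
          by (simp add: power2_eq_square algebra_simps)
        then show "2 * C * (d s i * (d s i + d s j)) \<le> 2 * C * (2 * (d s i)\<^sup>2 + (d s j)\<^sup>2)"
          using \<open>C \<ge> 0\<close> by (intro mult_left_mono) auto
      qed
      finally show "\<bar>2 * ((x s i - x 0 i) \<bullet> f s i)\<bar> \<le> \<dots>" .
    qed
    also have "\<dots> = (6 * C * card V) * g s"
      by (simp add: g_def sum.distrib sum_distrib_left[symmetric] algebra_simps)
    finally show ?thesis .
  qed
  have der: "(g has_real_derivative g' s) (at s within I)" if s: "s \<in> I" for s
  proof -
    have "((\<lambda>s. (x s i - x 0 i) \<bullet> (x s i - x 0 i)) has_real_derivative 2 * ((x s i - x 0 i) \<bullet> f s i)) (at s within I)"
      if "i \<in> V" for i
    proof -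
      have "((\<lambda>s. x s i - x 0 i) has_vector_derivative f s i) (at s within I)"
        using ode[OF s that] by (auto intro!: derivative_eq_intros simp: f_def)
      then have "((\<lambda>s. x s i - x 0 i) has_derivative (\<lambda>h. h *\<^sub>R f s i)) (at s within I)"
        by (simp add: has_vector_derivative_def)
      note has_derivative_inner[OF this this]
      moreover have "(\<lambda>h. (x s i - x 0 i) \<bullet> (h *\<^sub>R f s i) + (h *\<^sub>R f s i) \<bullet> (x s i - x 0 i)) =
          (*) (2 * ((x s i - x 0 i) \<bullet> f s i))"
        by (simp add: fun_eq_iff inner_commute algebra_simps)
      ultimately show ?thesis by (simp only: has_field_derivative_def)
    qed
    then have "((\<lambda>s. \<Sum>i\<in>V. (x s i - x 0 i) \<bullet> (x s i - x 0 i)) has_real_derivative g' s) (at s within I)"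
      unfolding g'_def by (intro DERIV_sum)
    then show ?thesis
      by (simp add: g_def[abs_def] d_def power2_norm_eq_inner)
  qed
  have "g t = 0"
  proof (rule gronwall_zero[OF I t der bound])
    show "0 \<le> g s" for s by (simp add: g_def sum_nonneg)
    show "g 0 = 0" by (simp add: g_def d_def)
  qed
  then have "(d t i)\<^sup>2 = 0"
    unfolding g_def using V i by (subst (asm) sum_nonneg_eq_0_iff) auto
  then show ?thesis by (simp add: d_def)
qed

section \<open>Equilibria from rotational symmetry\<close>

text \<open>A fixed point spans a chord of length 0, so its circle about \<open>n\<close> has radius
  0.\<close>

lemma parallel_if_rot_fixed:
  assumes n: "norm n = 1" and fixed: "rot n t s = s" and t: "cos t \<noteq> 1"
  shows "n \<times> s = 0"
proof -
  have "(norm s)\<^sup>2 = (n \<bullet> s)\<^sup>2"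
    using dist_rot[OF n, of s t] fixed t by simp
  then show ?thesis using norm_cross[of n s] n by simp
qed

lemma closed_loop_rhs_symmetric:
  assumes V: "Field E \<subseteq> V" and i: "i \<in> V" and inj: "inj_on G V" and n: "norm (G i) = 1"
    and t: "cos t \<noteq> 1"
    and aut: "graph_automorphism V E \<sigma>"
    and \<sigma>: "\<And>k. k \<in> V \<Longrightarrow> G (\<sigma> k) = rot (G i) t (G k)"
  shows "closed_loop_rhs h E G i = 0"
proof -
  define N where "N = {j. (i, j) \<in> E}"
  have N: "N \<subseteq> V" using V by (auto simp: N_def intro: FieldI2)
  have bij: "bij_betw \<sigma> V V" and E: "\<And>k j. \<lbrakk>k \<in> V; j \<in> V\<rbrakk> \<Longrightarrow> (\<sigma> k, \<sigma> j) \<in> E \<longleftrightarrow> (k, j) \<in> E"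
    using aut by (auto simp: graph_automorphism_def)
  have "\<sigma> i \<in> V" using bij i by (rule bij_betwE[THEN bspec])
  moreover have "G (\<sigma> i) = G i" using \<sigma>[OF i] by (simp add: rot_axis n)
  \<comment> \<open>The rotation fixes its own axis, and \<open>G\<close> is injective on
    \<open>V\<close>.\<close>
  ultimately have "\<sigma> i = i" using inj i by (auto dest: inj_onD)
  have "bij_betw \<sigma> N N"
  proof (rule bij_betw_subset[OF bij N])
    show "\<sigma> ` N = N"
    proof
      show "\<sigma> ` N \<subseteq> N" using E[OF i] N \<open>\<sigma> i = i\<close> by (auto simp: N_def)
      show "N \<subseteq> \<sigma> ` N"
      proof
        fix j assume j: "j \<in> N"
        then obtain k where "k \<in> V" "j = \<sigma> k" using N bij by (auto simp: bij_betw_def)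
        then show "j \<in> \<sigma> ` N" using E[OF i, of k] j \<open>\<sigma> i = i\<close> by (auto simp: N_def)
      qed
    qed
  qed
  define w where "w j = h (arccos (G i \<bullet> G j))" for j
  define s where "s = (\<Sum>j\<in>N. w j *\<^sub>R G j)"
  have "rot (G i) t s = (\<Sum>j\<in>N. w j *\<^sub>R rot (G i) t (G j))"
    unfolding s_def by (simp add: linear_sum[OF linear_rot] linear_cmul[OF linear_rot])
  \<comment> \<open>The weight of a neighbour depends only on its inner product with the axis, which
    the rotation preserves.\<close>
  also have "\<dots> = (\<Sum>j\<in>N. w (\<sigma> j) *\<^sub>R G (\<sigma> j))"
    using N \<sigma> by (intro sum.cong) (auto simp: w_def inner_rot_axis n)
  also have "\<dots> = s"
    unfolding s_def by (rule sum.reindex_bij_betw[OF \<open>bij_betw \<sigma> N N\<close>])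
  finally have "G i \<times> s = 0"
    using parallel_if_rot_fixed[OF n _ t] by blast
  moreover have "(\<Sum>j\<in>N. w j *\<^sub>R (G i \<times> G j)) = G i \<times> s"
    by (simp add: s_def cross_sum_right cross_mult_right)
  ultimately show ?thesis
    by (simp add: closed_loop_rhs_def N_def[symmetric] w_def[symmetric])
qed

text \<open>Rotations preserve inner and cross products. This equivariance transfers the equilibrium
  property from \<open>Gam\<close> to all its rotated copies.\<close>

lemma closed_loop_rhs_rotate:
  assumes R: "R \<in> SO3"
  shows "closed_loop_rhs h E (\<lambda>i. R *v G i) i = R *v closed_loop_rhs h E G i"
  unfolding closed_loop_rhs_sum
  by (simp add: SO3_inner[OF R] SO3_cross[OF R] linear_sum[OF matrix_vector_mul_linear]
      matrix_vector_mult_scaleR)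

text \<open>Invariance is stated for every solution on an interval around or bounded by time 0,
  hence in both time directions. The assumption \<open>aut\<close> speaks of any permutation that
  realises the rotation on indices; that one exists is part of the proof.\<close>

theorem theorem1:
  fixes p q :: nat
    and Gam :: "nat \<Rightarrow> real^3"
    and E :: "(nat \<times> nat) set"
    and h :: "real \<Rightarrow> real"
  assumes pq: "p \<ge> 3" "q \<ge> 3" "1 / real p + 1 / real q > 1 / 2"
    and poly: "\<exists>S. regular_polyhedron_vertices p q S \<and> (\<forall>v\<in>S. norm v = 1) \<and>
                   bij_betw Gam {1..N0 p q} S"
    and graph: "undirected_connected_graph {1..N0 p q} E"
    and aut: "\<And>i \<sigma>. i \<in> {1..N0 p q} \<Longrightarrow> bij_betw \<sigma> {1..N0 p q} {1..N0 p q} \<Longrightarrow>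
               (\<forall>k\<in>{1..N0 p q}. Gam (\<sigma> k) = mexp ((2 * pi / real q) *\<^sub>R hat (Gam i)) *v Gam k) \<Longrightarrow>
               graph_automorphism {1..N0 p q} E \<sigma>"
    and lip: "\<exists>L. L-lipschitz_on {-1..1} (h \<circ> arccos)"
  shows "\<forall>I x. is_interval I \<and> (0::real) \<in> I \<and>
           (\<forall>t\<in>I. \<forall>i\<in>{1..N0 p q}. norm (x t i) = 1) \<and>
           (\<forall>t\<in>I. \<forall>i\<in>{1..N0 p q}.
              ((\<lambda>s. x s i) has_vector_derivative closed_loop_rhs h E (x t) i) (at t within I)) \<and>
           (\<exists>R\<in>SO3. \<forall>i\<in>{1..N0 p q}. x 0 i = R *v Gam i)
         \<longrightarrow> (\<forall>t\<in>I. \<exists>R\<in>SO3. \<forall>i\<in>{1..N0 p q}. x t i = R *v Gam i)"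
proof (intro allI impI ballI, elim conjE bexE)
  fix I :: "real set" and x t R
  assume I: "is_interval I" "0 \<in> I" and t: "t \<in> I" and R: "R \<in> SO3"
    and unit: "\<forall>t\<in>I. \<forall>i\<in>{1..N0 p q}. norm (x t i) = 1"
    and ode: "\<forall>t\<in>I. \<forall>i\<in>{1..N0 p q}.
              ((\<lambda>s. x s i) has_vector_derivative closed_loop_rhs h E (x t) i) (at t within I)"
    and x0: "\<forall>i\<in>{1..N0 p q}. x 0 i = R *v Gam i"
  obtain S where S: "regular_polyhedron_vertices p q S" "\<forall>v\<in>S. norm v = 1"
    and Gam: "bij_betw Gam {1..N0 p q} S" using poly by blast
  obtain L where L: "L-lipschitz_on {-1..1} (h \<circ> arccos)" using lip by blast
  interpret inscribed_regular_polyhedron p q S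
    using pq S by unfold_locales auto
  define V where "V = {1..N0 p q}"
  have E: "Field E \<subseteq> V" using graph by (auto simp: undirected_connected_graph_def V_def Field_def)
  have GamV: "bij_betw Gam V S" using Gam by (simp add: V_def)
  have norm_Gam: "norm (Gam i) = 1" "Gam i \<in> S" if "i \<in> V" for i
    using GamV S(2) that by (auto simp: bij_betw_def)
  have "closed_loop_rhs h E Gam i = 0" if i: "i \<in> V" for i
  proof -
    have rot: "bij_betw (rot (Gam i) (2 * pi / q)) S S"
      using rot_vertices norm_Gam(2)[OF i] .
    \<comment> \<open>The rotation of the vertex set, transported to indices by the enumeration
      \<open>Gam\<close>.\<close>
    define \<sigma> where "\<sigma> = the_inv_into V Gam \<circ> rot (Gam i) (2 * pi / q) \<circ> Gam"
    have bij: "bij_betw \<sigma> V V"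
      unfolding \<sigma>_def using GamV rot bij_betw_the_inv_into[OF GamV] by (intro bij_betw_trans)
    have \<sigma>: "Gam (\<sigma> k) = rot (Gam i) (2 * pi / q) (Gam k)" if "k \<in> V" for k
    proof -
      have "rot (Gam i) (2 * pi / q) (Gam k) \<in> Gam ` V"
        using rot norm_Gam(2)[OF that] GamV by (auto simp: bij_betw_def)
      then show ?thesis using GamV by (simp add: \<sigma>_def bij_betw_def f_the_inv_into_f)
    qed
    have "graph_automorphism V E \<sigma>"
      unfolding V_def
      by (rule aut) (use i bij \<sigma> norm_Gam(1)[OF i] in \<open>auto simp: V_def mexp_hat\<close>)
    moreover have "cos (2 * pi / q) \<noteq> 1"
      using cos_less_one[of "2 * pi / q"] pq by (simp add: divide_less_eq)
    moreover have "inj_on Gam V" using GamV by (simp add: bij_betw_def)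
    ultimately show ?thesis
      using E i norm_Gam(1)[OF i] \<sigma> closed_loop_rhs_symmetric by blast
  qed
  then have "closed_loop_rhs h E (x 0) i = 0" if "i \<in> V" for i
  proof -
    \<comment> \<open>The configuration \<open>x 0\<close> is known on \<open>V\<close> only. That
      suffices because all neighbours lie in \<open>V\<close>.\<close>
    have "closed_loop_rhs h E (x 0) i = closed_loop_rhs h E (\<lambda>i. R *v Gam i) i"
      unfolding closed_loop_rhs_sum using x0 E that by (intro sum.cong) (auto simp: V_def dest: FieldI2)
    then show ?thesis
      using \<open>\<And>i. i \<in> V \<Longrightarrow> closed_loop_rhs h E Gam i = 0\<close>[OF that] by (simp add: closed_loop_rhs_rotate[OF R])
  qed
  then have "x t i = x 0 i" if "i \<in> V" for i
    using closed_loop_equilibrium_unique[OF _ E L I _ _ _ t that, of x] unit ode by (simp add: V_def)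
  \<comment> \<open>The solution stays at its initial value, so the initial rotation
    \<open>R\<close> serves at time \<open>t\<close> too.\<close>
  then show "\<exists>R\<in>SO3. \<forall>i\<in>{1..N0 p q}. x t i = R *v Gam i"
    using x0 R by (auto simp: V_def)
qed

end
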